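(* Let $\alpha=\begin{pmatrix}\alpha_{\bar12}&\alpha_{\bar14}\\ \alpha_{\bar32}&\alpha_{\bar34}\end{pmatrix}$ be a complex $2\times2$ matrix with $\det\alpha\neq\frac{x_2-x_4}{x_1-x_3}$ satisfying $$\langle\alpha,H\rangle=h_3(x_2-x_4)+h_3(x_1-x_3)\det\alpha,$$ let $\tilde\alpha=\frac{x_1-x_3}{x_2-x_4}\,\hat{\bar\alpha}$, and let the coordinates $w=(w_1,w_2,w_3,w_4)$ on $V$ be defined by $$\begin{pmatrix} z_1 \\ z_3 \end{pmatrix}=\begin{pmatrix} w_1 \\ w_3 \end{pmatrix}+\bar\alpha\begin{pmatrix} \bar w_2 \\ \bar w_4 \end{pmatrix},\qquad \begin{pmatrix} z_2 \\ z_4 \end{pmatrix}=\begin{pmatrix} w_2 \\ w_4 \end{pmatrix}+\bar{\tilde\alpha}\begin{pmatrix} \bar w_1 \\ \bar w_3 \end{pmatrix}.$$ Then the forms $A_1,A_2$ are of type $(1,1)$ with respect to the complex structure with holomorphic coordinates $w_i$. Further, if $\alpha$ also satisfies $$\alpha_{\bar34}=\frac{x_1-x_4}{x_2-x_3}\,\bar\alpha_{\bar12},\qquad \alpha_{\bar14}=-\frac{x_3-x_4}{x_1-x_2}\,\bar\alpha_{\bar32},$$ then $\omega$ is also of type $(1,1)$ with respect to the $w_i$.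
   Context: Setting. Let $P(x)=p_4x^4+p_2x^2+p_1x+p_0\in\mathbb{Q}[x]$ be irreducible with four real roots $x_1>x_2>x_3>x_4$, such that the splitting field $\mathbb{Q}(x_1,\dots,x_4)\subset\mathbb{R}$ has Galois group $S_4$. Put $\mathbb{D}=\prod_{i<j}(x_i-x_j)>0$, $\Delta=\mathbb{D}^2\in\mathbb{Q}$; it is assumed (after scaling the roots if necessary) that $\Delta$ is an integer. Let $F=\mathbb{Q}(x_1,i\mathbb{D})$, a field of degree 8. Its embeddings in $\mathbb{C}$ are $\varphi_j,\varphi_{\bar j}$ ($j=1,2,3,4$), where $\varphi_j(x_1)=x_j$, $\varphi_j(i\mathbb{D})=(-1)^{j+1}i\mathbb{D}$, and $\varphi_{\bar j}$ is the complex conjugate of $\varphi_j$. Let $V=\mathbb{R}\otimes_{\mathbb{Q}}F$, and let $z_j:V\to\mathbb{C}$ be the $\mathbb{R}$-linear extension of $\varphi_j$; $(z_1,z_2,z_3,z_4):V\to\mathbb{C}^4$ is an isomorphism of real vector spaces. Forms below are translation-invariant forms on $V$ (equivalently on the torus $V/\mathfrak{o}_F$). Let $\mu_j=\prod_{k\ne j}(x_j-x_k)$ and $\omega=\frac{i\mathbb{D}}{\Delta}(\mu_1dz_1\wedge d\bar z_1-\mu_2dz_2\wedge d\bar z_2+\mu_3dz_3\wedge d\bar z_3-\mu_4dz_4\wedge d\bar z_4)$. Let $h_2=x_1x_2+x_3x_4$, $h_3=x_1x_3+x_2x_4$, $h_4=x_1x_4+x_2x_3$, and set $h_{12}=h_{34}=h_2$,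 $h_{13}=h_{24}=h_3$, $h_{14}=h_{23}=h_4$. Put $e_1=dz_1$, $e_2=d\bar z_2$, $e_3=dz_3$, $e_4=d\bar z_4$ and $A_+=\sum_{1\le i<j\le 4}h_{ij}(x_i-x_j)\,e_i\wedge e_j$. Then $A_1=A_++\overline{A_+}$ and $A_2=ic\mathbb{D}\,(A_+-\overline{A_+})$, where $c$ is an integer. For a $2\times2$ matrix $A=\begin{pmatrix} a_{11} & a_{12} \\ a_{21} & a_{22} \end{pmatrix}$ put $\hat A=\begin{pmatrix} a_{22} & -a_{12} \\ -a_{21} & a_{11} \end{pmatrix}$ and $\langle A,B\rangle=\mathrm{Tr}(A\hat B)$. A bar over a matrix is entrywise complex conjugation. Let $$H=\begin{pmatrix} -h_4(x_2-x_3) & h_2(x_3-x_4) \\ -h_2(x_1-x_2) & -h_4(x_1-x_4) \end{pmatrix}.$$ *)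

theory Defs
  imports
    "HOL-Analysis.Analysis"
    "HOL-Computational_Algebra.Polynomial"
    "HOL-Algebra.Sym_Groups"
    "HOL-Algebra.Bij"
    "HOL-Algebra.Generated_Fields"
    "HOL-Algebra.Algebraic_Closure_Type"
begin

section \<open>Fields\<close>

definition adjoin :: "'a::field_char_0 set \<Rightarrow> 'a set"
  where "adjoin S = generate_field ring_of_type_algebra S"

definition subring_of :: "'a::field_char_0 set \<Rightarrow> 'a ring"
  where "subring_of K = ring_of_type_algebra\<lparr>carrier := K\<rparr>"

definition galois_group :: "'a::field_char_0 set \<Rightarrow> ('a \<Rightarrow> 'a) monoid"
  where "galois_group K =
    (BijGroup K)\<lparr>carrier :=
      {\<sigma> \<in> Bij K. \<sigma> \<in> ring_hom (subring_of K) (subring_of K) \<and> (\<forall>q\<in>\<rat>. \<sigma> q = q)}\<rparr>"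

definition embedding :: "complex set \<Rightarrow> (complex \<Rightarrow> complex) \<Rightarrow> bool"
  where "embedding F \<phi> \<longleftrightarrow> \<phi> \<in> ring_hom (subring_of F) ring_of_type_algebra"

section \<open>Extension of scalars\<close>

definition rat_scale :: "rat \<Rightarrow> complex \<Rightarrow> complex"
  where "rat_scale q a = of_rat q * a"

definition rat_linear_on :: "complex set \<Rightarrow> (complex \<Rightarrow> 'v::real_vector) \<Rightarrow> bool"
  where "rat_linear_on F f \<longleftrightarrow>
    (\<forall>a\<in>F. \<forall>b\<in>F. f (a + b) = f a + f b) \<and>
    (\<forall>q. \<forall>a\<in>F. f (rat_scale q a) = of_rat q *\<^sub>R f a)"

definition rat_basis :: "complex set \<Rightarrow> complex set \<Rightarrow> bool"
  where "rat_basis F B \<longleftrightarrow> \<not> module.dependent rat_scale B \<and> module.span rat_scale B = F"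

text \<open>
  The type \<open>'v\<close> together with \<open>\<iota>\<close> is a model of \<open>\<real> \<otimes>\<^sub>\<rat> F\<close>, where \<open>\<iota> a\<close> stands for
  \<open>1 \<otimes> a\<close>. Since the tensor product depends on the field \<open>F\<close>, which is a term, it cannot
  be a type of its own; it is therefore given by \<open>\<iota>\<close>, up to unique isomorphism, through the
  property that a basis of \<open>F\<close> over the rationals becomes a basis over the reals. The universal
  property of extension of scalars is \<open>scalar_extension_universal\<close> below.
\<close>

definition scalar_extension :: "complex set \<Rightarrow> (complex \<Rightarrow> 'v::real_vector) \<Rightarrow> bool"
  where "scalar_extension F \<iota> \<longleftrightarrow>
    rat_linear_on F \<iota> \<and>
    (\<forall>B. rat_basis F B \<longrightarrow> inj_on \<iota> B \<and> independent (\<iota> ` B) \<and> span (\<iota> ` B) = UNIV)"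

global_interpretation rat_vs: vector_space rat_scale
  by unfold_locales (simp_all add: rat_scale_def algebra_simps of_rat_add of_rat_mult)

lemma rat_linear_on_zero:
  assumes "rat_vs.subspace F" and "rat_linear_on F f"
  shows "f 0 = 0"
proof -
  have "0 \<in> F" using assms(1) by (rule rat_vs.subspace_0)
  then have "f (0 + 0) = f 0 + f 0"
    using assms(2) unfolding rat_linear_on_def by blast
  then show ?thesis by simp
qed

lemma rat_linear_on_step:
  assumes "rat_vs.subspace F" and "rat_linear_on F f" and "b \<in> F" "y \<in> F"
  shows "f (rat_scale q b + y) = of_rat q *\<^sub>R f b + f y"
  using assms rat_vs.subspace_scale[OF assms(1,3), of q] unfolding rat_linear_on_def by simp

lemma scalar_extension_universal:
  fixes \<iota> :: "complex \<Rightarrow> 'v::real_vector" and f :: "complex \<Rightarrow> 'w::real_vector"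
  assumes F: "rat_vs.subspace F" and \<iota>: "scalar_extension F \<iota>" and f: "rat_linear_on F f"
  shows "\<exists>!g. linear g \<and> (\<forall>a\<in>F. g (\<iota> a) = f a)"
proof -
  have lin: "rat_linear_on F \<iota>" using \<iota> by (simp add: scalar_extension_def)
  obtain B where BF: "B \<subseteq> F" and iB: "rat_vs.independent B" and sB: "F \<subseteq> rat_vs.span B"
    by (rule rat_vs.maximal_independent_subset)
  have FB: "rat_vs.span B = F" using rat_vs.span_minimal[OF BF F] sB by (rule equalityI)
  then have "rat_basis F B" using iB by (simp add: rat_basis_def)
  then have inj: "inj_on \<iota> B" and ind: "independent (\<iota> ` B)" and sp: "span (\<iota> ` B) = UNIV"
    using \<iota> by (simp_all add: scalar_extension_def)
  have agree: "g (\<iota> a) = f a"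
    if g: "linear g" and gB: "\<And>b. b \<in> B \<Longrightarrow> g (\<iota> b) = f b" and a: "a \<in> F" for g a
  proof -
    from a[folded FB] have "a \<in> F \<and> g (\<iota> a) = f a"
    proof (induction rule: rat_vs.span_induct_alt)
      case base
      show ?case
        using rat_linear_on_zero[OF F lin] rat_linear_on_zero[OF F f] linear_0[OF g]
          rat_vs.subspace_0[OF F] by simp
    next
      case (step q b y)
      have m: "b \<in> F" "y \<in> F" using step.hyps step.IH BF by auto
      have "rat_scale q b + y \<in> F"
        using m by (intro rat_vs.subspace_add[OF F] rat_vs.subspace_scale[OF F])
      then show ?case
        unfolding rat_linear_on_step[OF F lin m] rat_linear_on_step[OF F f m]
        using step.hyps(1) step.IH gB by (simp add: linear_add[OF g] linear_scale[OF g])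
    qed
    then show ?thesis by simp
  qed
  obtain g where g: "linear g" "\<And>y. y \<in> \<iota> ` B \<Longrightarrow> g y = f (inv_into B \<iota> y)"
    using linear_independent_extend[OF ind, of "\<lambda>y. f (inv_into B \<iota> y)"] by blast
  have "g (\<iota> b) = f b" if "b \<in> B" for b using g(2)[of "\<iota> b"] inj that by simp
  then have ex: "\<forall>a\<in>F. g (\<iota> a) = f a" using agree[OF g(1)] by blast
  show ?thesis
  proof (rule ex1I[of _ g])
    show "linear g \<and> (\<forall>a\<in>F. g (\<iota> a) = f a)" using g(1) ex by simp
  next
    fix g' assume g': "linear g' \<and> (\<forall>a\<in>F. g' (\<iota> a) = f a)"
    have eq: "g' y = g y" if "y \<in> \<iota> ` B" for y using that g' ex BF by auto
    show "g' = g"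
    proof
      fix v
      show "g' v = g v"
        by (rule linear_eq_on[OF conjunct1[OF g'] g(1) _ eq]) (simp_all add: sp)
    qed
  qed
qed

section \<open>Translation-invariant forms\<close>

text \<open>
  A translation-invariant complex-valued form on a real vector space is an alternating multilinear
  map. Thus for a linear function \<open>z\<close> the form \<open>dz\<close> is \<open>z\<close> itself, and
  its conjugate is \<open>\<lambda>v. cnj (z v)\<close>.
\<close>

type_synonym 'v form1 = "'v \<Rightarrow> complex"
type_synonym 'v form2 = "'v \<Rightarrow> 'v \<Rightarrow> complex"

definition conj1 :: "'v form1 \<Rightarrow> 'v form1"
  where "conj1 \<theta> = (\<lambda>v. cnj (\<theta> v))"

definition conj2 :: "'v form2 \<Rightarrow> 'v form2"
  where "conj2 \<Omega> = (\<lambda>u v. cnj (\<Omega> u v))"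

definition wedge :: "'v form1 \<Rightarrow> 'v form1 \<Rightarrow> 'v form2"
  where "wedge \<theta> \<eta> = (\<lambda>u v. \<theta> u * \<eta> v - \<theta> v * \<eta> u)"

definition complex_coordinates :: "(nat \<Rightarrow> 'v::real_vector \<Rightarrow> complex) \<Rightarrow> bool"
  where "complex_coordinates w \<longleftrightarrow>
    (\<forall>i\<in>{1..4}. linear (w i)) \<and> bij (\<lambda>v. (w 1 v, w 2 v, w 3 v, w 4 v))"

definition type_1_1 :: "(nat \<Rightarrow> 'v form1) \<Rightarrow> 'v form2 \<Rightarrow> bool"
  where "type_1_1 w \<Omega> \<longleftrightarrow>
    (\<exists>k. \<forall>u v. \<Omega> u v = (\<Sum>i=1..4. \<Sum>j=1..4. k i j * wedge (w i) (conj1 (w j)) u v))"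

section \<open>The particular forms\<close>

definition DD :: "(nat \<Rightarrow> real) \<Rightarrow> real"
  where "DD x = (\<Prod>(i, j)\<in>{(i, j). 1 \<le> i \<and> i < j \<and> j \<le> 4}. x i - x j)"

definition Delta :: "(nat \<Rightarrow> real) \<Rightarrow> real"
  where "Delta x = (DD x)\<^sup>2"

definition iDD :: "(nat \<Rightarrow> real) \<Rightarrow> complex"
  where "iDD x = \<i> * of_real (DD x)"

definition mu :: "(nat \<Rightarrow> real) \<Rightarrow> nat \<Rightarrow> real"
  where "mu x j = (\<Prod>k\<in>{1..4} - {j}. x j - x k)"

definition omega_form :: "(nat \<Rightarrow> real) \<Rightarrow> (nat \<Rightarrow> 'v form1) \<Rightarrow> 'v form2"
  where "omega_form x z = (\<lambda>u v. iDD x / of_real (Delta x) *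
    (\<Sum>j=1..4. (-1) ^ (j + 1) * of_real (mu x j) * wedge (z j) (conj1 (z j)) u v))"

definition h2 :: "(nat \<Rightarrow> real) \<Rightarrow> real" where "h2 x = x 1 * x 2 + x 3 * x 4"
definition h3 :: "(nat \<Rightarrow> real) \<Rightarrow> real" where "h3 x = x 1 * x 3 + x 2 * x 4"
definition h4 :: "(nat \<Rightarrow> real) \<Rightarrow> real" where "h4 x = x 1 * x 4 + x 2 * x 3"

text \<open>Only the values of \<open>h x i j\<close> for \<open>1 \<le> i < j \<le> 4\<close> are used.\<close>

definition h :: "(nat \<Rightarrow> real) \<Rightarrow> nat \<Rightarrow> nat \<Rightarrow> real"
  where "h x i j =
    (if (i, j) \<in> {(1, 2), (3, 4)} then h2 x
     else if (i, j) \<in> {(1, 3), (2, 4)} then h3 x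
     else h4 x)"

definition e_form :: "(nat \<Rightarrow> 'v form1) \<Rightarrow> nat \<Rightarrow> 'v form1"
  where "e_form z j = (if odd j then z j else conj1 (z j))"

definition A_plus :: "(nat \<Rightarrow> real) \<Rightarrow> (nat \<Rightarrow> 'v form1) \<Rightarrow> 'v form2"
  where "A_plus x z = (\<lambda>u v. \<Sum>(i, j)\<in>{(i, j). 1 \<le> i \<and> i < j \<and> j \<le> 4}.
    of_real (h x i j * (x i - x j)) * wedge (e_form z i) (e_form z j) u v)"

definition A1_form :: "(nat \<Rightarrow> real) \<Rightarrow> (nat \<Rightarrow> 'v form1) \<Rightarrow> 'v form2"
  where "A1_form x z = (\<lambda>u v. A_plus x z u v + conj2 (A_plus x z) u v)"

definition A2_form :: "(nat \<Rightarrow> real) \<Rightarrow> int \<Rightarrow> (nat \<Rightarrow> 'v form1) \<Rightarrow> 'v form2"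
  where "A2_form x c z = (\<lambda>u v. \<i> * of_int c * of_real (DD x) *
    (A_plus x z u v - conj2 (A_plus x z) u v))"

section \<open>Matrices and the new coordinates\<close>

definition mat2 :: "complex \<Rightarrow> complex \<Rightarrow> complex \<Rightarrow> complex \<Rightarrow> complex^2^2"
  where "mat2 a b c d = vector [vector [a, b], vector [c, d]]"

definition hat :: "complex^2^2 \<Rightarrow> complex^2^2"
  where "hat A = mat2 (A $ 2 $ 2) (- (A $ 1 $ 2)) (- (A $ 2 $ 1)) (A $ 1 $ 1)"

definition pairing :: "complex^2^2 \<Rightarrow> complex^2^2 \<Rightarrow> complex"
  where "pairing A B = trace (A ** hat B)"

definition cnj_mat :: "complex^2^2 \<Rightarrow> complex^2^2"
  where "cnj_mat A = (\<chi> i j. cnj (A $ i $ j))"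

definition H_mat :: "(nat \<Rightarrow> real) \<Rightarrow> complex^2^2"
  where "H_mat x = mat2
    (of_real (- h4 x * (x 2 - x 3))) (of_real (h2 x * (x 3 - x 4)))
    (of_real (- h2 x * (x 1 - x 2))) (of_real (- h4 x * (x 1 - x 4)))"

definition tilde :: "(nat \<Rightarrow> real) \<Rightarrow> complex^2^2 \<Rightarrow> complex^2^2"
  where "tilde x \<alpha> = ((x 1 - x 3) / (x 2 - x 4)) *\<^sub>R hat (cnj_mat \<alpha>)"

text \<open>
  The matrix \<open>\<alpha>\<close> has rows indexed by the barred indices 1, 3 and columns by the indices 2, 4, so
  its entry in position \<open>(2, 1)\<close> is the one called \<open>\<alpha>32\<close>.
\<close>

definition w_relation ::
  "(nat \<Rightarrow> real) \<Rightarrow> complex^2^2 \<Rightarrow> (nat \<Rightarrow> 'v \<Rightarrow> complex) \<Rightarrow> (nat \<Rightarrow> 'v \<Rightarrow> complex) \<Rightarrow> bool"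
  where "w_relation x \<alpha> z w \<longleftrightarrow> (\<forall>v.
    (vector [z 1 v, z 3 v] :: complex^2) =
      vector [w 1 v, w 3 v] + cnj_mat \<alpha> *v vector [cnj (w 2 v), cnj (w 4 v)] \<and>
    (vector [z 2 v, z 4 v] :: complex^2) =
      vector [w 2 v, w 4 v] + cnj_mat (tilde x \<alpha>) *v vector [cnj (w 1 v), cnj (w 3 v)])"

end

theory Submission
  imports Defs
begin

text \<open>
  The theorem combines a computation in the exterior algebra with the fact that
  \<open>z 1, z 2, z 3, z 4\<close> are complex coordinates on the real vector space.

  \<^bold>\<open>Types.\<close> The relation between \<open>z\<close> and \<open>w\<close> says that \<open>z j\<close> is \<open>w j\<close> plus the conjugate of a
  complex linear combination \<open>conj_part x \<alpha> w j\<close> of the \<open>w i\<close>, where \<open>i\<close> has the parity opposite to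
  \<open>j\<close>; the coefficients are those of \<open>\<alpha>\<close> for odd \<open>j\<close> and those of its tilde for even \<open>j\<close>. A wedge
  product of two such sums has mixed terms, which are of type (1,1), and two pure terms, so only
  the vanishing of the (2,0) and (0,2) parts is at stake (\<open>type_1_1_sum_wedge\<close>). The four forms
  \<open>e_form z j\<close> all lie in the span of \<open>w 1\<close>, \<open>w 3\<close> and the conjugates of \<open>w 2\<close>, \<open>w 4\<close>. Hence the
  (0,2) part of \<open>A_plus\<close> is a multiple of a single wedge product, and the coefficient is the
  conjugate of the difference of the two sides of the hypothesis on \<open>pairing \<alpha> (H_mat x)\<close>. The tilde
  of \<open>\<alpha>\<close> is made in such a way that the coefficient of the (2,0) part is a real multiple of the same
  number (\<open>type_1_1_A_plus\<close>). For \<open>omega_form\<close> the pure parts have one coefficient for each pair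
  \<open>w i, w j\<close> with \<open>i\<close> odd and \<open>j\<close> even, and the two extra conditions on \<open>\<alpha>\<close> make
  these four coefficients vanish (\<open>type_1_1_omega\<close>).

  \<^bold>\<open>Coordinates.\<close> Let \<open>C\<close> be the antilinear map that sends a family \<open>y\<close> to the conjugates of
  \<open>conj_part x \<alpha> y\<close>, so that \<open>z = w + C w\<close>. A 2 by 2 matrix times its hat is its determinant, so
  \<open>C (C w)\<close> is a scalar multiple of \<open>w\<close> on the odd indices and a conjugate multiple on the even
  ones. Therefore \<open>z - C z = w - C (C w)\<close> determines \<open>w\<close>, unless the scalar is 1, which is what the
  condition on \<open>det \<alpha>\<close> excludes. This gives existence of \<open>w\<close>, and it reduces
  \<open>complex_coordinates w\<close> to the bijectivity of \<open>z\<close> (\<open>complex_coordinates_w\<close>).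

  For that (\<open>bij_embeddings\<close>), let \<open>D = DD x\<close>. Since \<open>x 1\<close> is a root of an irreducible polynomial
  of degree 4 and \<open>D\<^sup>2\<close> is rational, \<open>F\<close> is spanned over the rationals by the
  powers of \<open>x 1\<close> with exponent below 4 and their multiples by \<open>\<i> D\<close>. So every vector is
  given by two real polynomials \<open>p\<close>, \<open>q\<close> of degree below 4, and \<open>z j\<close> takes on it the value with real
  part \<open>p (x j)\<close> and imaginary part \<open>\<plusminus> D q (x j)\<close>. Interpolation at the four distinct roots makes
  \<open>z\<close> surjective, and a polynomial of degree below 4 with four roots is zero, which makes
  \<open>z\<close> injective.
\<close>

(* Formal power series use the same symbol for coefficients; with both readings the number of
   parses of a term grows exponentially with the number of vector components in it. *)
no_notation fps_nth (infixl \<open>$\<close> 75)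

section \<open>Forms of type (1,1)\<close>

definition type_1_0 :: "(nat \<Rightarrow> 'v form1) \<Rightarrow> 'v form1 \<Rightarrow> bool"
  where "type_1_0 w \<eta> \<longleftrightarrow> (\<exists>a. \<forall>v. \<eta> v = (\<Sum>i=1..4. a i * w i v))"

lemma sum_1_4: "(\<Sum>i=1..4. f i) = f 1 + f 2 + f 3 + f (4::nat)" for f :: "nat \<Rightarrow> 'a::comm_monoid_add"
  by (simp add: eval_nat_numeral)

lemma ball_1_4: "(\<forall>i\<in>{1..4::nat}. P i) \<longleftrightarrow> P 1 \<and> P 2 \<and> P 3 \<and> P 4"
proof -
  have "{1..4::nat} = {1, 2, 3, 4}" by auto
  then show ?thesis by simp
qed

lemma sum_pairs_1_4:
  "(\<Sum>s\<in>{(i, j). 1 \<le> i \<and> i < j \<and> j \<le> 4}. f s) =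
     f (1, 2) + f (1, 3) + f (1, 4) + f (2, 3) + f (2, 4) + f (3, 4::nat)"
  for f :: "nat \<times> nat \<Rightarrow> 'a::comm_monoid_add"
proof -
  have "{(i, j). 1 \<le> i \<and> i < j \<and> j \<le> 4} = {(1, 2), (1, 3), (1, 4), (2, 3), (2, 4), (3, 4::nat)}"
    by auto
  then show ?thesis by (simp add: add.assoc)
qed

lemma type_1_0_coordinate: "i \<in> {1..4} \<Longrightarrow> type_1_0 w (w i)"
  unfolding type_1_0_def
  by (intro exI[of _ "\<lambda>j. if j = i then 1 else 0"]) (simp add: mult_delta_left del: One_nat_def)

lemma type_1_0_lincomb:
  assumes "type_1_0 w \<eta>" and "type_1_0 w \<theta>"
  shows "type_1_0 w (\<lambda>v. a * \<eta> v + b * \<theta> v)"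
proof -
  obtain k l where "\<And>v. \<eta> v = (\<Sum>i=1..4. k i * w i v)" "\<And>v. \<theta> v = (\<Sum>i=1..4. l i * w i v)"
    using assms unfolding type_1_0_def by blast
  then show ?thesis
    unfolding type_1_0_def
    by (intro exI[of _ "\<lambda>i. a * k i + b * l i"])
      (simp add: sum_distrib_left sum.distrib algebra_simps)
qed

lemma type_1_1_wedge:
  assumes "type_1_0 w \<eta>" and "type_1_0 w \<theta>"
  shows "type_1_1 w (wedge \<eta> (conj1 \<theta>))"
proof -
  obtain k l where e: "\<And>v. \<eta> v = (\<Sum>i=1..4. k i * w i v)" "\<And>v. \<theta> v = (\<Sum>i=1..4. l i * w i v)"
    using assms unfolding type_1_0_def by blast
  show ?thesis
    unfolding type_1_1_def
    by (intro exI[of _ "\<lambda>i j. k i * cnj (l j)"])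
      (simp add: wedge_def conj1_def e sum_product sum_subtractf[symmetric] cnj_sum algebra_simps)
qed

lemma type_1_1_add:
  assumes "type_1_1 w \<Omega>" and "type_1_1 w \<Psi>"
  shows "type_1_1 w (\<lambda>u v. \<Omega> u v + \<Psi> u v)"
proof -
  obtain k l where "\<And>u v. \<Omega> u v = (\<Sum>i=1..4. \<Sum>j=1..4. k i j * wedge (w i) (conj1 (w j)) u v)"
    "\<And>u v. \<Psi> u v = (\<Sum>i=1..4. \<Sum>j=1..4. l i j * wedge (w i) (conj1 (w j)) u v)"
    using assms unfolding type_1_1_def by blast
  then show ?thesis
    unfolding type_1_1_def
    by (intro exI[of _ "\<lambda>i j. k i j + l i j"]) (simp add: sum.distrib algebra_simps)
qed

lemma type_1_1_scale:
  assumes "type_1_1 w \<Omega>"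
  shows "type_1_1 w (\<lambda>u v. a * \<Omega> u v)"
proof -
  obtain k where "\<And>u v. \<Omega> u v = (\<Sum>i=1..4. \<Sum>j=1..4. k i j * wedge (w i) (conj1 (w j)) u v)"
    using assms unfolding type_1_1_def by blast
  then show ?thesis
    unfolding type_1_1_def
    by (intro exI[of _ "\<lambda>i j. a * k i j"]) (simp add: sum_distrib_left mult.assoc)
qed

lemma type_1_1_diff:
  assumes "type_1_1 w \<Omega>" and "type_1_1 w \<Psi>"
  shows "type_1_1 w (\<lambda>u v. \<Omega> u v - \<Psi> u v)"
  using type_1_1_add[OF assms(1) type_1_1_scale[OF assms(2), of "- 1"]] by simp

lemma type_1_1_sum:
  assumes "\<And>s. s \<in> S \<Longrightarrow> type_1_1 w (\<Omega> s)"
  shows "type_1_1 w (\<lambda>u v. \<Sum>s\<in>S. \<Omega> s u v)"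
  using assms
proof (induction S rule: infinite_finite_induct)
  case (insert s S)
  then show ?case
    using type_1_1_add[of w "\<Omega> s" "\<lambda>u v. \<Sum>s\<in>S. \<Omega> s u v"] by simp
qed (auto simp: type_1_1_def intro: exI[of _ "\<lambda>i j. 0"])

lemma type_1_1_conj2:
  assumes "type_1_1 w \<Omega>"
  shows "type_1_1 w (conj2 \<Omega>)"
proof -
  obtain k where k: "\<And>u v. \<Omega> u v = (\<Sum>i=1..4. \<Sum>j=1..4. k i j * wedge (w i) (conj1 (w j)) u v)"
    using assms unfolding type_1_1_def by blast
  have "conj2 \<Omega> u v = (\<Sum>i=1..4. \<Sum>j=1..4. - cnj (k j i) * wedge (w i) (conj1 (w j)) u v)" for u v
    unfolding conj2_def k cnj_sum
    by (subst sum.swap) (simp add: wedge_def conj1_def algebra_simps)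
  then show ?thesis
    unfolding type_1_1_def by (intro exI[of _ "\<lambda>i j. - cnj (k j i)"]) simp
qed

text \<open>
  Each factor is a (1,0) form plus the conjugate of one. The four products of such parts are two
  mixed terms and two pure ones, and the pure ones add up to zero by hypothesis. The (0,2) part is
  given through its conjugate, so that both hypotheses are about (1,0) forms.
\<close>

lemma type_1_1_sum_wedge:
  assumes \<eta>: "\<And>s. s \<in> S \<Longrightarrow> type_1_0 w (\<eta> s)" and \<theta>: "\<And>s. s \<in> S \<Longrightarrow> type_1_0 w (\<theta> s)"
    and \<eta>': "\<And>s. s \<in> S \<Longrightarrow> type_1_0 w (\<eta>' s)" and \<theta>': "\<And>s. s \<in> S \<Longrightarrow> type_1_0 w (\<theta>' s)"
    and pure20: "\<And>u v. (\<Sum>s\<in>S. c s * wedge (\<eta> s) (\<eta>' s) u v) = 0"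
    and pure02: "\<And>u v. (\<Sum>s\<in>S. cnj (c s) * wedge (\<theta> s) (\<theta>' s) u v) = 0"
    and e: "\<And>s v. s \<in> S \<Longrightarrow> e s v = \<eta> s v + cnj (\<theta> s v)"
    and e': "\<And>s v. s \<in> S \<Longrightarrow> e' s v = \<eta>' s v + cnj (\<theta>' s v)"
  shows "type_1_1 w (\<lambda>u v. \<Sum>s\<in>S. c s * wedge (e s) (e' s) u v)"
proof -
  \<comment> \<open>the mixed terms\<close>
  let ?m = "\<lambda>s u v. c s * (wedge (\<eta> s) (conj1 (\<theta>' s)) u v - wedge (\<eta>' s) (conj1 (\<theta> s)) u v)"
  have "(\<Sum>s\<in>S. c s * wedge (e s) (e' s) u v) = (\<Sum>s\<in>S. ?m s u v)" for u v
  proof -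
    have "(\<Sum>s\<in>S. c s * wedge (e s) (e' s) u v) =
      (\<Sum>s\<in>S. ?m s u v + c s * wedge (\<eta> s) (\<eta>' s) u v + cnj (cnj (c s) * wedge (\<theta> s) (\<theta>' s) u v))"
      by (rule sum.cong) (simp_all add: e e' wedge_def conj1_def algebra_simps)
    also have "\<dots> = (\<Sum>s\<in>S. ?m s u v)"
      by (simp only: sum.distrib cnj_sum[symmetric] pure20 pure02) simp
    finally show ?thesis .
  qed
  moreover have "type_1_1 w (\<lambda>u v. \<Sum>s\<in>S. ?m s u v)"
    by (rule type_1_1_sum, rule type_1_1_scale, rule type_1_1_diff)
      (simp_all add: type_1_1_wedge \<eta> \<theta> \<eta>' \<theta>')
  ultimately show ?thesis by simp
qed

section \<open>The types of the given forms\<close>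


text \<open>
  The relation between the two coordinate systems is \<open>z j = w j + cnj (conj_part x \<alpha> w j)\<close>. It is
  written for an arbitrary family of functions since it is also applied to \<open>z\<close> below.
\<close>

definition conj_part :: "(nat \<Rightarrow> real) \<Rightarrow> complex^2^2 \<Rightarrow> (nat \<Rightarrow> 'v form1) \<Rightarrow> nat \<Rightarrow> 'v form1"
  where "conj_part x \<alpha> w j = (\<lambda>v.
    if j = 1 then \<alpha> $ 1 $ 1 * w 2 v + \<alpha> $ 1 $ 2 * w 4 v
    else if j = 3 then \<alpha> $ 2 $ 1 * w 2 v + \<alpha> $ 2 $ 2 * w 4 v
    else if j = 2 then tilde x \<alpha> $ 1 $ 1 * w 1 v + tilde x \<alpha> $ 1 $ 2 * w 3 v
    else tilde x \<alpha> $ 2 $ 1 * w 1 v + tilde x \<alpha> $ 2 $ 2 * w 3 v)"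

lemma w_relation_iff:
  "w_relation x \<alpha> z w \<longleftrightarrow> (\<forall>j\<in>{1..4}. \<forall>v. z j v = w j v + cnj (conj_part x \<alpha> w j v))"
proof -
  have "w_relation x \<alpha> z w \<longleftrightarrow> (\<forall>v. \<forall>j\<in>{1..4}. z j v = w j v + cnj (conj_part x \<alpha> w j v))"
    unfolding w_relation_def ball_1_4
    by (rule iff_allI) (simp add: conj_part_def cnj_mat_def vec_eq_iff forall_2
        matrix_vector_mult_def sum_2 vector_2 conj_ac del: One_nat_def)
  then show ?thesis by blast
qed

lemma type_1_0_conj_part: "type_1_0 w (conj_part x \<alpha> w j)"
proof -
  have *: "type_1_0 w (\<lambda>v. a * w i v + b * w k v)" if "i \<in> {1..4}" "k \<in> {1..4}" for a b i k
    by (intro type_1_0_lincomb type_1_0_coordinate that)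
  consider "j = 1" | "j = 2" | "j = 3" | "j \<notin> {1, 2, 3}" by blast
  then show ?thesis
    by cases (simp_all add: conj_part_def * del: One_nat_def)
qed

lemma mat2_nth [simp]:
  "mat2 a b c d $ 1 $ 1 = a" "mat2 a b c d $ 1 $ 2 = b"
  "mat2 a b c d $ 2 $ 1 = c" "mat2 a b c d $ 2 $ 2 = d"
  by (simp_all add: mat2_def vector_2)

lemma tilde_nth:
  assumes "r = of_real ((x 1 - x 3) / (x 2 - x 4))"
  shows "tilde x \<alpha> $ 1 $ 1 = r * cnj (\<alpha> $ 2 $ 2)" "tilde x \<alpha> $ 1 $ 2 = - (r * cnj (\<alpha> $ 1 $ 2))"
    "tilde x \<alpha> $ 2 $ 1 = - (r * cnj (\<alpha> $ 2 $ 1))" "tilde x \<alpha> $ 2 $ 2 = r * cnj (\<alpha> $ 1 $ 1)"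
  unfolding tilde_def hat_def assms
  by (simp_all add: cnj_mat_def scaleR_conv_of_real[where 'a = complex] del: One_nat_def)

lemma pairing_H_mat:
  "pairing \<alpha> (H_mat x) =
     - of_real (h4 x * (x 1 - x 4)) * \<alpha> $ 1 $ 1 + of_real (h2 x * (x 1 - x 2)) * \<alpha> $ 1 $ 2
     - of_real (h2 x * (x 3 - x 4)) * \<alpha> $ 2 $ 1 - of_real (h4 x * (x 2 - x 3)) * \<alpha> $ 2 $ 2"
  by (simp add: pairing_def H_mat_def hat_def trace_def matrix_matrix_mult_def sum_2 algebra_simps)

text \<open>
  The six coefficients of \<open>A_plus\<close> are related by \<open>k (1, 3) = r * k (2, 4)\<close>, where \<open>r\<close> is the
  real factor in the tilde of \<open>\<alpha>\<close>. This is why the (2,0) and the (0,2) part vanish for the same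
  reason: if the hypothesis on the pairing is written as \<open>E = 0\<close>, with the right hand side minus the
  left hand side as \<open>E\<close>, their coefficients are \<open>r\<close> times the conjugate of \<open>E\<close> and the conjugate of \<open>E\<close>.
\<close>

lemma type_1_1_A_plus:
  assumes w: "w_relation x \<alpha> z w" and d: "x 2 \<noteq> x 4"
    and pairing: "pairing \<alpha> (H_mat x) =
      of_real (h3 x * (x 2 - x 4)) + of_real (h3 x * (x 1 - x 3)) * det \<alpha>"
  shows "type_1_1 w (A_plus x z)"
proof -
  let ?q = "conj_part x \<alpha> w"
  \<comment> \<open>\<open>e_form z j\<close> is \<open>z j\<close> or its conjugate, so the parity of \<open>j\<close> decides which part is holomorphic.\<close>
  define \<eta> where "\<eta> j = (if odd j then w j else ?q j)" for j
  define \<theta> where "\<theta> j = (if odd j then ?q j else w j)" for j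
  define S where "S = {(i, j). 1 \<le> i \<and> i < j \<and> j \<le> (4::nat)}"
  define k where "k s = (case s of (i, j) \<Rightarrow> complex_of_real (h x i j * (x i - x j)))" for s
  define r where "r = complex_of_real ((x 1 - x 3) / (x 2 - x 4))"
  have in_S: "fst s \<in> {1..4}" "snd s \<in> {1..4}" if "s \<in> S" for s
    using that by (auto simp: S_def)
  have t: "type_1_0 w (\<eta> j)" "type_1_0 w (\<theta> j)" if "j \<in> {1..4}" for j
    using that by (simp_all add: \<eta>_def \<theta>_def type_1_0_conj_part type_1_0_coordinate)
  have e: "e_form z j v = \<eta> j v + cnj (\<theta> j v)" if "j \<in> {1..4}" for j v
    using w that unfolding w_relation_iff by (simp add: e_form_def conj1_def \<eta>_def \<theta>_def)
  have k24: "k (1, 3) = r * k (2, 4)"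
    using d by (simp add: k_def r_def h_def field_simps)
  have E: "- k (1, 2) * \<alpha> $ 1 $ 2 + k (1, 4) * \<alpha> $ 1 $ 1 + k (2, 3) * \<alpha> $ 2 $ 2 + k (3, 4) * \<alpha> $ 2 $ 1
      + k (2, 4) + r * k (2, 4) * (\<alpha> $ 1 $ 1 * \<alpha> $ 2 $ 2 - \<alpha> $ 1 $ 2 * \<alpha> $ 2 $ 1) = 0"
    using pairing unfolding k24[symmetric] pairing_H_mat det_2
    by (simp add: k_def h_def algebra_simps)
  have cnj_k: "cnj (k s) = k s" for s by (simp add: k_def split: prod.split)
  have cnj_r: "cnj r = r" by (simp add: r_def)
  have E': "- k (1, 2) * cnj (\<alpha> $ 1 $ 2) + k (1, 4) * cnj (\<alpha> $ 1 $ 1) + k (2, 3) * cnj (\<alpha> $ 2 $ 2)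
      + k (3, 4) * cnj (\<alpha> $ 2 $ 1) + k (2, 4)
      + r * k (2, 4) * (cnj (\<alpha> $ 1 $ 1) * cnj (\<alpha> $ 2 $ 2) - cnj (\<alpha> $ 1 $ 2) * cnj (\<alpha> $ 2 $ 1)) = 0"
    using arg_cong[OF E, of cnj] by (simp add: cnj_k cnj_r)
  have "(\<Sum>s\<in>S. cnj (k s) * wedge (\<theta> (fst s)) (\<theta> (snd s)) u v) = 0" for u v
  proof -
    have "(\<Sum>s\<in>S. cnj (k s) * wedge (\<theta> (fst s)) (\<theta> (snd s)) u v) =
      (- k (1, 2) * \<alpha> $ 1 $ 2 + k (1, 4) * \<alpha> $ 1 $ 1 + k (2, 3) * \<alpha> $ 2 $ 2 + k (3, 4) * \<alpha> $ 2 $ 1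
      + k (2, 4) + r * k (2, 4) * (\<alpha> $ 1 $ 1 * \<alpha> $ 2 $ 2 - \<alpha> $ 1 $ 2 * \<alpha> $ 2 $ 1)) * wedge (w 2) (w 4) u v"
      unfolding S_def sum_pairs_1_4 cnj_k k24
      by (simp add: \<theta>_def conj_part_def wedge_def algebra_simps del: One_nat_def)
    then show ?thesis unfolding E by simp
  qed
  moreover have "(\<Sum>s\<in>S. k s * wedge (\<eta> (fst s)) (\<eta> (snd s)) u v) = 0" for u v
  proof -
    have "(\<Sum>s\<in>S. k s * wedge (\<eta> (fst s)) (\<eta> (snd s)) u v) =
      r * (- k (1, 2) * cnj (\<alpha> $ 1 $ 2) + k (1, 4) * cnj (\<alpha> $ 1 $ 1) + k (2, 3) * cnj (\<alpha> $ 2 $ 2)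
      + k (3, 4) * cnj (\<alpha> $ 2 $ 1) + k (2, 4)
      + r * k (2, 4) * (cnj (\<alpha> $ 1 $ 1) * cnj (\<alpha> $ 2 $ 2) - cnj (\<alpha> $ 1 $ 2) * cnj (\<alpha> $ 2 $ 1))) * wedge (w 1) (w 3) u v"
      unfolding S_def sum_pairs_1_4 k24
      by (simp add: \<eta>_def conj_part_def tilde_nth[OF r_def] wedge_def algebra_simps del: One_nat_def)
    then show ?thesis unfolding E' by simp
  qed
  ultimately have "type_1_1 w (\<lambda>u v. \<Sum>s\<in>S. k s * wedge (e_form z (fst s)) (e_form z (snd s)) u v)"
    by (intro type_1_1_sum_wedge[where \<eta> = "\<lambda>s. \<eta> (fst s)" and \<theta> = "\<lambda>s. \<theta> (fst s)"
          and \<eta>' = "\<lambda>s. \<eta> (snd s)" and \<theta>' = "\<lambda>s. \<theta> (snd s)"] t e in_S) auto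
  then show ?thesis
    by (simp add: A_plus_def k_def S_def case_prod_unfold)
qed

text \<open>
  In \<open>z j\<close> wedge its conjugate, the (2,0) part is \<open>w j\<close> wedge \<open>conj_part x \<alpha> w j\<close>, and the (0,2) part
  is minus its conjugate. The weights in \<open>omega_form\<close> are real up to a common factor, so both parts
  vanish together. The coefficient of each \<open>w i\<close> wedge \<open>w j\<close> receives one contribution from \<open>\<alpha>\<close>
  and one from its tilde; the extra conditions on \<open>\<alpha>\<close> turn their cancellation into
  relations between the \<open>mu x j\<close>, in which the differences of the roots cancel.
\<close>

lemma type_1_1_omega:
  assumes w: "w_relation x \<alpha> z w" and order: "x 1 > x 2" "x 2 > x 3" "x 3 > x 4"
    and \<alpha>34: "\<alpha> $ 2 $ 2 = of_real ((x 1 - x 4) / (x 2 - x 3)) * cnj (\<alpha> $ 1 $ 1)"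
    and \<alpha>14: "\<alpha> $ 1 $ 2 = - of_real ((x 3 - x 4) / (x 1 - x 2)) * cnj (\<alpha> $ 2 $ 1)"
  shows "type_1_1 w (omega_form x z)"
proof -
  let ?q = "conj_part x \<alpha> w"
  define k where "k j = (-1) ^ (j + 1) * complex_of_real (mu x j)" for j
  define r where "r = complex_of_real ((x 1 - x 3) / (x 2 - x 4))"
  have z: "z j v = w j v + cnj (?q j v)" if "j \<in> {1..4}" for j v
    using w that unfolding w_relation_iff by blast
  have cnj_k: "cnj (k j) = k j" for j by (simp add: k_def)
  have S: "{1..4} - {1} = {2, 3, 4::nat}" "{1..4} - {2} = {1, 3, 4::nat}"
    "{1..4} - {3} = {1, 2, 4::nat}" "{1..4} - {4} = {1, 2, 3::nat}" by auto
  have mu: "mu x 1 = (x 1 - x 2) * (x 1 - x 3) * (x 1 - x 4)"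
    "mu x 2 = (x 2 - x 1) * (x 2 - x 3) * (x 2 - x 4)"
    "mu x 3 = (x 3 - x 1) * (x 3 - x 2) * (x 3 - x 4)"
    "mu x 4 = (x 4 - x 1) * (x 4 - x 2) * (x 4 - x 3)"
    unfolding mu_def S by (simp_all add: mult.assoc)
  have nz: "x 1 \<noteq> x 2" "x 2 \<noteq> x 3" "x 2 \<noteq> x 4" using order by auto
  define f where "f = (x 1 - x 4) / (x 2 - x 3)"
  define g where "g = (x 3 - x 4) / (x 1 - x 2)"
  define r' where "r' = (x 1 - x 3) / (x 2 - x 4)"
  have "(x 2 - x 3) * f = x 1 - x 4" "(x 1 - x 2) * g = x 3 - x 4" "(x 2 - x 4) * r' = x 1 - x 3"
    using nz by (simp_all add: f_def g_def r'_def)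
  note fgr = this
  have e: "mu x 2 * r' * f = (x 2 - x 1) * ((x 2 - x 4) * r') * ((x 2 - x 3) * f)"
    "mu x 1 * g = (x 1 - x 3) * (x 1 - x 4) * ((x 1 - x 2) * g)"
    "mu x 4 * r' = - ((x 4 - x 1) * (x 4 - x 3) * ((x 2 - x 4) * r'))"
    "mu x 2 * r' * g = - ((x 2 - x 3) * ((x 2 - x 4) * r') * ((x 1 - x 2) * g))"
    "mu x 3 * f = - ((x 3 - x 1) * (x 3 - x 4) * ((x 2 - x 3) * f))"
    unfolding mu by (simp_all add: algebra_simps del: One_nat_def)
  have R: "mu x 1 = - (mu x 2 * r' * f)" "mu x 1 * g = - (mu x 4 * r')"
    "mu x 3 = - (mu x 2 * r' * g)" "mu x 3 * f = - (mu x 4 * r')"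
    unfolding e unfolding fgr mu by (simp_all add: algebra_simps del: One_nat_def)
  have c: "complex_of_real (mu x 1) = - (of_real (mu x 2) * r * of_real f)"
    "complex_of_real (mu x 1) * of_real g = - (of_real (mu x 4) * r)"
    "complex_of_real (mu x 3) = - (of_real (mu x 2) * r * of_real g)"
    "complex_of_real (mu x 3) * of_real f = - (of_real (mu x 4) * r)"
    using R[THEN arg_cong[where f = complex_of_real]] unfolding r_def r'_def by simp_all
  have k: "k 1 = of_real (mu x 1)" "k 2 = - of_real (mu x 2)"
    "k 3 = of_real (mu x 3)" "k 4 = - of_real (mu x 4)"
    by (simp_all add: k_def)
  have \<alpha>': "\<alpha> $ 2 $ 2 = of_real f * cnj (\<alpha> $ 1 $ 1)" "\<alpha> $ 1 $ 2 = - of_real g * cnj (\<alpha> $ 2 $ 1)"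
    unfolding f_def g_def by (rule \<alpha>34 \<alpha>14)+
  have E: "k 1 * \<alpha> $ 1 $ 1 - k 2 * r * cnj (\<alpha> $ 2 $ 2) = 0"
    unfolding k \<alpha>' c(1) by (simp add: algebra_simps del: One_nat_def)
  have E2: "k 1 * \<alpha> $ 1 $ 2 + k 4 * r * cnj (\<alpha> $ 2 $ 1) = 0"
    using arg_cong[OF c(2), of "\<lambda>t. - t * cnj (\<alpha> $ 2 $ 1)"]
    unfolding k \<alpha>' by (simp add: algebra_simps del: One_nat_def)
  have E3: "k 3 * \<alpha> $ 2 $ 1 + k 2 * r * cnj (\<alpha> $ 1 $ 2) = 0"
    unfolding k \<alpha>' c(3) by (simp add: algebra_simps del: One_nat_def)
  have E4: "k 3 * \<alpha> $ 2 $ 2 - k 4 * r * cnj (\<alpha> $ 1 $ 1) = 0"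
    using arg_cong[OF c(4), of "\<lambda>t. t * cnj (\<alpha> $ 1 $ 1)"]
    unfolding k \<alpha>' by (simp add: algebra_simps del: One_nat_def)
  have pure: "(\<Sum>j=1..4. k j * wedge (w j) (?q j) u v) = 0" for u v
  proof -
    have "(\<Sum>j=1..4. k j * wedge (w j) (?q j) u v) =
      (k 1 * \<alpha> $ 1 $ 1 - k 2 * r * cnj (\<alpha> $ 2 $ 2)) * wedge (w 1) (w 2) u v
      + (k 1 * \<alpha> $ 1 $ 2 + k 4 * r * cnj (\<alpha> $ 2 $ 1)) * wedge (w 1) (w 4) u v
      + (k 3 * \<alpha> $ 2 $ 1 + k 2 * r * cnj (\<alpha> $ 1 $ 2)) * wedge (w 3) (w 2) u v
      + (k 3 * \<alpha> $ 2 $ 2 - k 4 * r * cnj (\<alpha> $ 1 $ 1)) * wedge (w 3) (w 4) u v"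
      unfolding sum_1_4
      by (simp add: conj_part_def tilde_nth[OF r_def] wedge_def algebra_simps del: One_nat_def)
    then show ?thesis unfolding E E2 E3 E4 by simp
  qed
  have "(\<Sum>j=1..4. cnj (k j) * wedge (?q j) (w j) u v) = - (\<Sum>j=1..4. k j * wedge (w j) (?q j) u v)" for u v
    unfolding cnj_k sum_negf[symmetric] by (simp add: wedge_def algebra_simps)
  then have "type_1_1 w (\<lambda>u v. \<Sum>j=1..4. k j * wedge (z j) (conj1 (z j)) u v)"
    by (intro type_1_1_sum_wedge[where \<eta> = w and \<theta> = ?q and \<eta>' = ?q and \<theta>' = w])
      (simp_all add: pure z conj1_def type_1_0_conj_part type_1_0_coordinate del: One_nat_def)
  from type_1_1_scale[OF this] show ?thesis
    unfolding omega_form_def k_def .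
qed

section \<open>Solving for the coordinates w\<close>

text \<open>
  The factor by which \<open>w j\<close> is multiplied in \<open>z - C z\<close>, with \<open>C\<close> the antilinear map
  \<open>y \<mapsto> cnj (conj_part x \<alpha> y)\<close>.
\<close>

definition denom :: "(nat \<Rightarrow> real) \<Rightarrow> complex^2^2 \<Rightarrow> nat \<Rightarrow> complex"
  where "denom x \<alpha> j = 1 - of_real ((x 1 - x 3) / (x 2 - x 4)) * (if odd j then cnj (det \<alpha>) else det \<alpha>)"

lemma conj_part_diff:
  "conj_part x \<alpha> (\<lambda>i v. f i v - g i v) j v = conj_part x \<alpha> f j v - conj_part x \<alpha> g j v"
  by (simp add: conj_part_def algebra_simps del: One_nat_def)

text \<open>
  \<open>conj_part\<close> exchanges the parities, hence a scaling that depends on the parity only comes out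
  with the other factor.
\<close>

lemma conj_part_divide:
  assumes "j \<in> {1..4}"
  shows "conj_part x \<alpha> (\<lambda>i v. f i v / (if odd i then a else b)) j v =
    conj_part x \<alpha> f j v / (if odd j then b else a)"
proof -
  have "\<forall>j\<in>{1..4}. conj_part x \<alpha> (\<lambda>i v. f i v / (if odd i then a else b)) j v =
    conj_part x \<alpha> f j v / (if odd j then b else a)"
    unfolding ball_1_4 by (simp add: conj_part_def add_divide_distrib del: One_nat_def)
  then show ?thesis using assms by blast
qed

text \<open>
  Applying \<open>C\<close> twice multiplies the odd part by \<open>\<alpha>\<close> conjugated times the tilde of \<open>\<alpha>\<close>, and the even part
  by the conjugate of the tilde times \<open>\<alpha>\<close>. Both products are scalar, since a 2 by 2 matrix times its
  hat is its determinant.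
\<close>

lemma conj_part_twice:
  assumes "j \<in> {1..4}"
  shows "cnj (conj_part x \<alpha> (\<lambda>i v. cnj (conj_part x \<alpha> w i v)) j v) = (1 - denom x \<alpha> j) * w j v"
proof -
  define r where "r = complex_of_real ((x 1 - x 3) / (x 2 - x 4))"
  have "cnj r = r" by (simp add: r_def)
  then have "\<forall>j\<in>{1..4}. cnj (conj_part x \<alpha> (\<lambda>i v. cnj (conj_part x \<alpha> w i v)) j v) = (1 - denom x \<alpha> j) * w j v"
    unfolding ball_1_4 denom_def r_def[symmetric]
    by (simp add: conj_part_def tilde_nth[OF r_def] det_2 algebra_simps del: One_nat_def)
  then show ?thesis using assms by blast
qed

lemma w_from_z:
  assumes w: "w_relation x \<alpha> z w" and j: "j \<in> {1..4}"
  shows "denom x \<alpha> j * w j v = z j v - cnj (conj_part x \<alpha> z j v)"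
proof -
  let ?C = "\<lambda>y i v. cnj (conj_part x \<alpha> y i v)"
  have z: "z i v = w i v + ?C w i v" if "i \<in> {1..4}" for i
    using w that unfolding w_relation_iff by blast
  have "conj_part x \<alpha> w j v = conj_part x \<alpha> (\<lambda>i v. z i v - ?C w i v) j v"
    by (simp add: conj_part_def z)
  then have "conj_part x \<alpha> z j v = conj_part x \<alpha> w j v + conj_part x \<alpha> (?C w) j v"
    by (simp add: conj_part_diff)
  then have "?C z j v = ?C w j v + (1 - denom x \<alpha> j) * w j v"
    by (simp add: conj_part_twice[OF j])
  then show ?thesis by (simp add: z[OF j] algebra_simps)
qed

lemma denom_parity:
  "denom x \<alpha> j = (if odd j then denom x \<alpha> 1 else cnj (denom x \<alpha> 1))"
  by (simp add: denom_def)

lemma denom_nonzero: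
  assumes "det \<alpha> * of_real ((x 1 - x 3) / (x 2 - x 4)) \<noteq> 1"
  shows "denom x \<alpha> j \<noteq> 0"
proof -
  have "cnj (denom x \<alpha> 1) = 1 - det \<alpha> * of_real ((x 1 - x 3) / (x 2 - x 4))"
    unfolding denom_def
    by (simp only: complex_cnj_diff complex_cnj_mult complex_cnj_complex_of_real) (simp add: mult.commute)
  then have "cnj (denom x \<alpha> 1) \<noteq> 0" using assms by simp
  then show ?thesis by (subst denom_parity) simp
qed

text \<open>
  Dividing \<open>z - C z\<close> by the scalars gives a solution because the scalar for even indices is conjugate
  to the one for odd indices, which is how the antilinear \<open>C\<close> commutes with the division.
\<close>

lemma w_relation_solution:
  assumes "det \<alpha> * of_real ((x 1 - x 3) / (x 2 - x 4)) \<noteq> 1"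
  shows "w_relation x \<alpha> z (\<lambda>j v. (z j v - cnj (conj_part x \<alpha> z j v)) / denom x \<alpha> j)"
proof -
  let ?C = "\<lambda>y i v. cnj (conj_part x \<alpha> y i v)"
  let ?y = "\<lambda>i v. z i v - ?C z i v"
  have "?C (\<lambda>i v. ?y i v / denom x \<alpha> i) j v = ?C ?y j v / denom x \<alpha> j" if "j \<in> {1..4}" for j v
  proof -
    have "denom x \<alpha> = (\<lambda>i. if odd i then denom x \<alpha> 1 else cnj (denom x \<alpha> 1))"
      by (rule ext) (rule denom_parity)
    then obtain \<delta> where \<delta>: "denom x \<alpha> = (\<lambda>i. if odd i then \<delta> else cnj \<delta>)" by blast
    show ?thesis unfolding \<delta> by (subst conj_part_divide[OF that]) simp
  qed
  moreover have "?C ?y j v = ?C z j v - (1 - denom x \<alpha> j) * z j v" if "j \<in> {1..4}" for j v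
    using conj_part_twice[OF that, of x \<alpha> z v] by (simp add: conj_part_diff)
  ultimately have "?y j v / denom x \<alpha> j + ?C (\<lambda>i v. ?y i v / denom x \<alpha> i) j v = z j v"
    if "j \<in> {1..4}" for j v
    using that denom_nonzero[OF assms, of j] by (simp add: field_simps)
  then show ?thesis
    unfolding w_relation_iff by simp
qed

text \<open>
  Linearity comes from the formula for \<open>w\<close> in terms of \<open>z\<close>, and injectivity from the formula for \<open>z\<close>
  in terms of \<open>w\<close>. For surjectivity, the values prescribed for \<open>w\<close> determine values of \<open>z\<close>; these
  are attained, and solving for \<open>w\<close> gives back the prescribed values.
\<close>

lemma complex_coordinates_w:
  assumes w: "w_relation x \<alpha> z w" and nz: "det \<alpha> * of_real ((x 1 - x 3) / (x 2 - x 4)) \<noteq> 1"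
    and lin: "\<And>j. j \<in> {1..4} \<Longrightarrow> linear (z j)" and bij: "bij (\<lambda>v. (z 1 v, z 2 v, z 3 v, z 4 v))"
  shows "complex_coordinates w"
proof -
  have d: "denom x \<alpha> j \<noteq> 0" for j
    using denom_nonzero[OF nz] .
  have sol: "w j v = (z j v - cnj (conj_part x \<alpha> z j v)) / denom x \<alpha> j" if "j \<in> {1..4}" for j v
    using w_from_z[OF w that, of v] d by (simp add: field_simps)
  have z: "z j v = w j v + cnj (conj_part x \<alpha> w j v)" if "j \<in> {1..4}" for j v
    using w that unfolding w_relation_iff by blast
  have linear: "linear (w j)" if j: "j \<in> {1..4}" for j
  proof -
    have 4: "1 \<in> {1..4::nat}" "2 \<in> {1..4::nat}" "3 \<in> {1..4::nat}" "4 \<in> {1..4::nat}" by auto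
    note z_simps = 4[THEN lin, THEN linear_add] 4[THEN lin, THEN linear_scale]
      lin[OF j, THEN linear_add] lin[OF j, THEN linear_scale]
    have "linear (\<lambda>v. (z j v - cnj (conj_part x \<alpha> z j v)) / denom x \<alpha> j)"
    proof (rule linearI)
      fix u v
      have "conj_part x \<alpha> z j (u + v) = conj_part x \<alpha> z j u + conj_part x \<alpha> z j v"
        by (simp add: conj_part_def z_simps algebra_simps del: One_nat_def)
      then show "(z j (u + v) - cnj (conj_part x \<alpha> z j (u + v))) / denom x \<alpha> j =
        (z j u - cnj (conj_part x \<alpha> z j u)) / denom x \<alpha> j + (z j v - cnj (conj_part x \<alpha> z j v)) / denom x \<alpha> j"
        by (simp add: z_simps add_divide_distrib diff_divide_distrib)
    next
      fix c :: real and v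
      have "conj_part x \<alpha> z j (c *\<^sub>R v) = c *\<^sub>R conj_part x \<alpha> z j v"
        by (simp add: conj_part_def z_simps scaleR_add_right del: One_nat_def)
      then show "(z j (c *\<^sub>R v) - cnj (conj_part x \<alpha> z j (c *\<^sub>R v))) / denom x \<alpha> j =
        c *\<^sub>R ((z j v - cnj (conj_part x \<alpha> z j v)) / denom x \<alpha> j)"
        by (simp add: z_simps scaleR_conv_of_real diff_divide_distrib right_diff_distrib)
    qed
    moreover have "w j = (\<lambda>v. (z j v - cnj (conj_part x \<alpha> z j v)) / denom x \<alpha> j)"
      by (rule ext) (rule sol[OF j])
    ultimately show ?thesis by simp
  qed
  moreover have "bij (\<lambda>v. (w 1 v, w 2 v, w 3 v, w 4 v))"
  proof (rule bijI)
    show "inj (\<lambda>v. (w 1 v, w 2 v, w 3 v, w 4 v))"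
    proof (rule injI)
      fix u v assume "(w 1 u, w 2 u, w 3 u, w 4 u) = (w 1 v, w 2 v, w 3 v, w 4 v)"
      then have "(z 1 u, z 2 u, z 3 u, z 4 u) = (z 1 v, z 2 v, z 3 v, z 4 v)"
        by (simp add: z conj_part_def del: One_nat_def)
      then show "u = v" using bij by (meson bij_is_inj injD)
    qed
    have "\<exists>v. s = (w 1 v, w 2 v, w 3 v, w 4 v)" for s
    proof -
      obtain s1 s2 s3 s4 where s: "s = (s1, s2, s3, s4)" by (cases s)
      \<comment> \<open>The prescribed values and the resulting values of \<open>z\<close> as constant functions, so that \<open>w_from_z\<close> applies to them.\<close>
      define S :: "nat \<Rightarrow> 'a \<Rightarrow> complex"
        where "S j = (\<lambda>_. if j = 1 then s1 else if j = 2 then s2 else if j = 3 then s3 else s4)" for j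
      define Z where "Z j v = S j v + cnj (conj_part x \<alpha> S j v)" for j v
      have rel: "w_relation x \<alpha> Z S" unfolding w_relation_iff Z_def by blast
      have "\<exists>v. (Z 1 undefined, Z 2 undefined, Z 3 undefined, Z 4 undefined) = (z 1 v, z 2 v, z 3 v, z 4 v)"
        using bij_is_surj[OF bij] unfolding surj_def by blast
      then obtain v where
        "(Z 1 undefined, Z 2 undefined, Z 3 undefined, Z 4 undefined) = (z 1 v, z 2 v, z 3 v, z 4 v)"
        by blast
      then have zv: "z 1 v = Z 1 v" "z 2 v = Z 2 v" "z 3 v = Z 3 v" "z 4 v = Z 4 v"
        by (simp_all add: Z_def S_def conj_part_def del: One_nat_def)
      have "w j v = S j v" if j: "j \<in> {1..4}" for j
      proof -
        have "\<forall>j\<in>{1..4}. z j v = Z j v" unfolding ball_1_4 using zv by blast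
        then have "z j v = Z j v" "conj_part x \<alpha> z j v = conj_part x \<alpha> Z j v"
          using j zv by (auto simp add: conj_part_def simp del: One_nat_def)
        then have "denom x \<alpha> j * w j v = denom x \<alpha> j * S j v"
          unfolding w_from_z[OF w j] w_from_z[OF rel j] by simp
        then show ?thesis using d by simp
      qed
      then show ?thesis by (intro exI[of _ v]) (simp add: s S_def)
    qed
    then show "surj (\<lambda>v. (w 1 v, w 2 v, w 3 v, w 4 v))" unfolding surj_def by blast
  qed
  ultimately show ?thesis by (simp add: complex_coordinates_def)
qed

section \<open>Elements of a finitely generated field\<close>

lemma ring_of_type_algebra_simps [simp]:
  fixes a b :: "'a::field_char_0"
  shows "\<one>\<^bsub>ring_of_type_algebra\<^esub> = (1::'a)" "\<zero>\<^bsub>ring_of_type_algebra\<^esub> = (0::'a)"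
    "a \<oplus>\<^bsub>ring_of_type_algebra\<^esub> b = a + b" "a \<otimes>\<^bsub>ring_of_type_algebra\<^esub> b = a * b"
    "carrier ring_of_type_algebra = (UNIV :: 'a set)"
  by (simp_all add: ring_of_type_algebra_def)

lemma a_inv_ring_of_type_algebra [simp]: "\<ominus>\<^bsub>ring_of_type_algebra\<^esub> a = - a"
  for a :: "'a::field_char_0"
proof -
  interpret R: field "ring_of_type_algebra :: 'a ring" by (rule field_from_type_algebra)
  show ?thesis by (rule R.minus_equality) simp_all
qed

lemma m_inv_ring_of_type_algebra [simp]:
  "a \<noteq> 0 \<Longrightarrow> inv\<^bsub>ring_of_type_algebra\<^esub> a = inverse a"
  for a :: "'a::field_char_0"
proof -
  assume a: "a \<noteq> 0"
  interpret R: field "ring_of_type_algebra :: 'a ring" by (rule field_from_type_algebra)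
  show ?thesis by (rule R.inv_unique'[symmetric]) (use a in simp_all)
qed

lemma adjoin_induct [consumes 1, case_names one generator minus inverse add mult]:
  assumes "a \<in> adjoin S" and "P 1" and "\<And>s. s \<in> S \<Longrightarrow> P s"
    and "\<And>a. P a \<Longrightarrow> P (- a)" and "\<And>a. P a \<Longrightarrow> a \<noteq> 0 \<Longrightarrow> P (inverse a)"
    and "\<And>a b. P a \<Longrightarrow> P b \<Longrightarrow> P (a + b)" and "\<And>a b. P a \<Longrightarrow> P b \<Longrightarrow> P (a * b)"
  shows "P a"
  using assms(1) unfolding adjoin_def
  by (induction rule: generate_field.induct) (simp_all add: assms(2-))

lemma adjoin_one: "1 \<in> adjoin S"
  using generate_field.one[of ring_of_type_algebra S] by (simp add: adjoin_def)

lemma adjoin_generator: "s \<in> S \<Longrightarrow> s \<in> adjoin S"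
  by (simp add: adjoin_def generate_field.incl)

lemma adjoin_minus: "a \<in> adjoin S \<Longrightarrow> - a \<in> adjoin S"
  using generate_field.a_inv[of a ring_of_type_algebra S] by (simp add: adjoin_def)

lemma adjoin_inverse: "a \<in> adjoin S \<Longrightarrow> a \<noteq> 0 \<Longrightarrow> inverse a \<in> adjoin S"
  using generate_field.m_inv[of a ring_of_type_algebra S] by (simp add: adjoin_def)

lemma adjoin_add: "a \<in> adjoin S \<Longrightarrow> b \<in> adjoin S \<Longrightarrow> a + b \<in> adjoin S"
  using generate_field.eng_add[of a ring_of_type_algebra S b] by (simp add: adjoin_def)

lemma adjoin_mult: "a \<in> adjoin S \<Longrightarrow> b \<in> adjoin S \<Longrightarrow> a * b \<in> adjoin S"
  using generate_field.eng_mult[of a ring_of_type_algebra S b] by (simp add: adjoin_def)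

lemma adjoin_power: "a \<in> adjoin S \<Longrightarrow> a ^ k \<in> adjoin S"
  by (induction k) (simp_all add: adjoin_one adjoin_mult)

lemma adjoin_zero: "0 \<in> adjoin S"
  using adjoin_add[OF adjoin_one adjoin_minus[OF adjoin_one]] by simp

lemma adjoin_of_int: "of_int m \<in> adjoin S"
proof -
  have nat: "of_nat n \<in> adjoin S" for n
    by (induction n) (simp_all add: adjoin_zero adjoin_add adjoin_one)
  show ?thesis
    by (cases m rule: int_cases2) (simp_all add: nat adjoin_minus)
qed

lemma adjoin_of_rat: "of_rat q \<in> adjoin S"
proof (cases q)
  case (Fract a b)
  then show ?thesis
    using adjoin_mult[OF adjoin_of_int[of a S] adjoin_inverse[OF adjoin_of_int[of b S]]]
    by (simp add: of_rat_rat divide_inverse)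
qed

lemma subspace_adjoin: "rat_vs.subspace (adjoin S)"
  by (rule rat_vs.subspaceI)
    (simp_all add: rat_scale_def adjoin_zero adjoin_add adjoin_mult adjoin_of_rat)

section \<open>Adjoining a root of an irreducible polynomial and an imaginary square root\<close>

lemma of_real_of_rat: "complex_of_real (of_rat q) = of_rat q"
  by (cases q) (simp add: of_rat_rat)

definition rat_eval :: "complex \<Rightarrow> rat poly \<Rightarrow> complex"
  where "rat_eval t p = poly (map_poly of_rat p) t"

lemma rat_eval_pCons: "rat_eval t (pCons a p) = of_rat a + t * rat_eval t p"
  by (simp add: rat_eval_def map_poly_pCons)

lemma rat_eval_0 [simp]: "rat_eval t 0 = 0"
  by (simp add: rat_eval_def)

lemma rat_eval_1 [simp]: "rat_eval t 1 = 1"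
  by (simp add: rat_eval_def)

lemma rat_eval_add: "rat_eval t (p + q) = rat_eval t p + rat_eval t q"
  by (induction p q rule: poly_induct2) (simp_all add: rat_eval_pCons of_rat_add algebra_simps)

lemma rat_eval_smult: "rat_eval t (Polynomial.smult c p) = of_rat c * rat_eval t p"
  by (induction p) (simp_all add: rat_eval_pCons of_rat_mult algebra_simps)

lemma rat_eval_mult: "rat_eval t (p * q) = rat_eval t p * rat_eval t q"
  by (induction p) (simp_all add: rat_eval_pCons rat_eval_add rat_eval_smult algebra_simps)

lemma rat_eval_minus: "rat_eval t (- p) = - rat_eval t p"
  using rat_eval_smult[of t "- 1" p] by (simp add: of_rat_minus)

lemma cnj_rat_eval: "cnj (rat_eval (of_real y) p) = rat_eval (of_real y) p"
proof (induction p)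
  case (pCons a p)
  have "cnj (of_rat a) = of_rat a"
    by (metis complex_cnj_complex_of_real of_real_of_rat)
  then show ?case using pCons by (simp add: rat_eval_pCons)
qed simp

lemma rat_eval_mod:
  assumes "rat_eval t P = 0"
  shows "rat_eval t (a mod P) = rat_eval t a"
proof -
  have "rat_eval t a = rat_eval t (a div P * P + a mod P)" by simp
  also have "\<dots> = rat_eval t (a mod P)"
    by (simp only: rat_eval_add rat_eval_mult assms) simp
  finally show ?thesis by simp
qed

lemma poly_eq_sum_lessThan:
  fixes t :: "'a::comm_semiring_1"
  assumes "Polynomial.degree p < n"
  shows "poly p t = (\<Sum>k<n. Polynomial.coeff p k * t ^ k)"
proof -
  have "poly p t = (\<Sum>k\<le>Polynomial.degree p. Polynomial.coeff p k * t ^ k)" by (rule Polynomial.poly_altdef)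
  also have "\<dots> = (\<Sum>k<n. Polynomial.coeff p k * t ^ k)"
    using assms by (intro sum.mono_neutral_left) (auto simp: coeff_eq_0)
  finally show ?thesis .
qed

text \<open>A Bezout relation between the irreducible \<open>P\<close> and \<open>a\<close>, evaluated at the root of \<open>P\<close>.\<close>

lemma rat_eval_inverse:
  assumes "Factorial_Ring.irreducible P" and "rat_eval t P = 0" and "rat_eval t a \<noteq> 0"
  shows "\<exists>b. rat_eval t b * rat_eval t a = 1"
proof -
  have "\<not> P dvd a"
    using assms(2,3) by (auto simp: rat_eval_mult elim!: dvdE)
  then have "coprime P a"
    by (rule prime_elem_imp_coprime[OF irreducible_imp_prime_elem[OF assms(1)]])
  then have "fst (bezout_coefficients P a) * P + snd (bezout_coefficients P a) * a = 1"
    by (simp add: bezout_coefficients_fst_snd)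
  from arg_cong[OF this, of "rat_eval t"] show ?thesis
    using assms(2) by (auto simp: rat_eval_add rat_eval_mult)
qed

text \<open>
  The sums on the right form a field. The only interesting operation is inversion: the product of
  such a number with its complex conjugate is a polynomial in \<open>y\<close> because \<open>D\<^sup>2\<close> is rational, so it
  has an inverse of this kind.
\<close>

lemma adjoin_imaginary_quadratic:
  fixes y D :: real and d :: rat
  assumes P: "Factorial_Ring.irreducible P" "rat_eval (of_real y) P = 0" and d: "D\<^sup>2 = of_rat d"
    and a: "a \<in> adjoin {of_real y, \<i> * of_real D}"
  shows "\<exists>p q. a = rat_eval (of_real y) p + \<i> * of_real D * rat_eval (of_real y) q"
  using a
proof (induction rule: adjoin_induct)
  case one
  show ?case by (intro exI[of _ 1] exI[of _ 0]) simp
next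
  case (generator s)
  then consider "s = of_real y" | "s = \<i> * of_real D" by blast
  then show ?case
  proof cases
    case 1
    then show ?thesis by (intro exI[of _ "[:0, 1:]"] exI[of _ 0]) (simp add: rat_eval_pCons)
  next
    case 2
    then show ?thesis by (intro exI[of _ 0] exI[of _ 1]) simp
  qed
next
  case (minus a)
  then obtain p q where "a = rat_eval y p + \<i> * D * rat_eval y q" by blast
  then show ?case
    by (intro exI[of _ "- p"] exI[of _ "- q"]) (simp add: rat_eval_minus)
next
  case (add a b)
  then obtain p q p' q' where "a = rat_eval y p + \<i> * D * rat_eval y q"
    "b = rat_eval y p' + \<i> * D * rat_eval y q'" by blast
  then show ?case
    by (intro exI[of _ "p + p'"] exI[of _ "q + q'"]) (simp add: rat_eval_add algebra_simps)
next
  case (mult a b)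
  then obtain p q p' q' where "a = rat_eval y p + \<i> * D * rat_eval y q"
    "b = rat_eval y p' + \<i> * D * rat_eval y q'" by blast
  moreover have "of_rat d = complex_of_real D * of_real D"
    using arg_cong[OF d, of complex_of_real] by (simp add: power2_eq_square of_real_of_rat)
  ultimately show ?case
    by (intro exI[of _ "p * p' + - Polynomial.smult d (q * q')"] exI[of _ "p * q' + q * p'"])
      (simp add: rat_eval_add rat_eval_mult rat_eval_smult rat_eval_minus algebra_simps
        del: add_uminus_conv_diff)
next
  case (inverse a)
  then obtain p q where a: "a = rat_eval y p + \<i> * D * rat_eval y q" by blast
  have D: "complex_of_real D * of_real D = of_rat d"
    using arg_cong[OF d, of complex_of_real] by (simp add: power2_eq_square of_real_of_rat)
  have cnj: "cnj a = rat_eval y p - \<i> * D * rat_eval y q"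
    by (simp add: a cnj_rat_eval)
  let ?n = "p * p + Polynomial.smult d (q * q)"
  have n: "a * cnj a = rat_eval y ?n"
    unfolding cnj unfolding a
    by (simp add: rat_eval_add rat_eval_mult rat_eval_smult D[symmetric] algebra_simps)
  then have "rat_eval y ?n \<noteq> 0" using \<open>a \<noteq> 0\<close> by (metis complex_cnj_zero_iff mult_eq_0_iff)
  from rat_eval_inverse[OF P this] obtain u where u: "rat_eval y u * (a * cnj a) = 1"
    unfolding n by blast
  have "inverse a = rat_eval y u * cnj a"
    using u \<open>a \<noteq> 0\<close> by (simp add: inverse_unique mult_ac)
  then show ?case
    unfolding cnj
    by (intro exI[of _ "u * p"] exI[of _ "- (u * q)"])
      (simp add: rat_eval_mult rat_eval_minus algebra_simps)
qed

text \<open>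
  Reducing the two polynomials modulo \<open>P\<close> bounds their degrees.
\<close>

lemma adjoin_imaginary_quadratic_span:
  fixes y D :: real and d :: rat
  assumes P: "Factorial_Ring.irreducible P" "rat_eval (of_real y) P = 0" and d: "D\<^sup>2 = of_rat d"
    and a: "a \<in> adjoin {of_real y, \<i> * of_real D}" and n: "Polynomial.degree P = n"
  shows "\<exists>p q. a = (\<Sum>k<n. rat_scale (p k) (of_real y ^ k))
    + (\<Sum>k<n. rat_scale (q k) (\<i> * of_real D * of_real y ^ k))"
proof -
  obtain p q where pq: "a = rat_eval y p + \<i> * of_real D * rat_eval y q"
    using adjoin_imaginary_quadratic[OF P d a] by blast
  have "P \<noteq> 0" using P(1) by auto
  have "n > 0"
  proof (rule ccontr)
    assume "\<not> n > 0"
    then obtain c where "P = [:c:]" using n by (metis degree_eq_zeroE not_gr_zero)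
    then show False using P(2) \<open>P \<noteq> 0\<close> by (simp add: rat_eval_pCons)
  qed
  have deg: "Polynomial.degree (f mod P) < n" for f
    using degree_mod_less[OF \<open>P \<noteq> 0\<close>, of f] n \<open>n > 0\<close> by auto
  have sum: "rat_eval y f = (\<Sum>k<n. of_rat (Polynomial.coeff (f mod P) k) * of_real y ^ k)" for f
  proof -
    have "rat_eval y f = rat_eval y (f mod P)" by (rule rat_eval_mod[OF P(2), symmetric])
    also have "\<dots> = (\<Sum>k<n. of_rat (Polynomial.coeff (f mod P) k) * of_real y ^ k)"
      unfolding rat_eval_def using deg[of f]
      by (subst poly_eq_sum_lessThan[where n = n]) (simp_all add: coeff_map_poly degree_map_poly)
    finally show ?thesis .
  qed
  show ?thesis
    unfolding pq sum
    by (intro exI[of _ "Polynomial.coeff (p mod P)"] exI[of _ "Polynomial.coeff (q mod P)"])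
      (simp add: rat_scale_def sum_distrib_left mult_ac)
qed

section \<open>Bijectivity of the extended embeddings\<close>

lemma rat_linear_on_sum:
  assumes F: "rat_vs.subspace F" and f: "rat_linear_on F f" and b: "\<And>k. k \<in> K \<Longrightarrow> b k \<in> F"
  shows "f (\<Sum>k\<in>K. rat_scale (q k) (b k)) = (\<Sum>k\<in>K. of_rat (q k) *\<^sub>R f (b k))"
  using b
proof (induction K rule: infinite_finite_induct)
  case (insert k K)
  then have "(\<Sum>k\<in>K. rat_scale (q k) (b k)) \<in> F"
    by (intro rat_vs.subspace_sum[OF F] rat_vs.subspace_scale[OF F]) auto
  then show ?case
    using insert by (simp add: rat_linear_on_step[OF F f])
qed (simp_all add: rat_linear_on_zero[OF F f])

text \<open>
  A further node is added through a multiple of the polynomial that vanishes at the previous nodes.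
\<close>

lemma interpolation:
  fixes x f :: "'i \<Rightarrow> 'a::field"
  assumes "finite I" and "I \<noteq> {}" and "inj_on x I"
  shows "\<exists>p. Polynomial.degree p < card I \<and> (\<forall>i\<in>I. poly p (x i) = f i)"
  using assms
proof (induction I rule: finite_ne_induct)
  case (singleton i)
  show ?case by (intro exI[of _ "[:f i:]"]) simp
next
  case (insert i I)
  then obtain p where p: "Polynomial.degree p < card I" "\<forall>j\<in>I. poly p (x j) = f j" by auto
  define q where "q = (\<Prod>j\<in>I. [:- x j, 1:])"
  have deg: "Polynomial.degree q \<le> card I"
    unfolding q_def using degree_prod_sum_le[OF \<open>finite I\<close>, of "\<lambda>j. [:- x j, 1:]"] by simp
  have q: "poly q (x i) \<noteq> 0" "\<forall>j\<in>I. poly q (x j) = 0"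
    using insert by (auto simp: q_def poly_prod)
  let ?p = "p + Polynomial.smult ((f i - poly p (x i)) / poly q (x i)) q"
  have "Polynomial.degree ?p < card (insert i I)"
    using insert(1,3) p(1) deg
    by (intro degree_add_less) (auto intro: le_less_trans[OF degree_smult_le])
  moreover have "\<forall>j\<in>insert i I. poly ?p (x j) = f j" using p q by simp
  ultimately show ?case by blast
qed

text \<open>
  The elements listed in \<open>span\<close> generate \<open>F\<close> over the rationals, so their images generate the
  extension of scalars over the reals. Hence every vector is a real combination \<open>comb p q\<close>. If \<open>z\<close>
  vanishes on it, so do its coefficients, because a polynomial of degree below 4 is determined by its
  values at the four \<open>x j\<close>; interpolation at the \<open>x j\<close> yields coefficients with prescribed values of \<open>z\<close>.
\<close>

lemma bij_embeddings:
  fixes \<iota> :: "complex \<Rightarrow> 'v::real_vector" and z :: "nat \<Rightarrow> 'v \<Rightarrow> complex" and y D :: real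
  assumes F: "rat_vs.subspace F" and V: "scalar_extension F \<iota>"
    and t: "\<And>k. of_real y ^ k \<in> F" "\<And>k. \<i> * of_real D * of_real y ^ k \<in> F"
    and span: "\<And>a. a \<in> F \<Longrightarrow> \<exists>p q. a = (\<Sum>k<4. rat_scale (p k) (of_real y ^ k))
        + (\<Sum>k<4. rat_scale (q k) (\<i> * of_real D * of_real y ^ k))"
    and lin: "\<And>j. j \<in> {1..4} \<Longrightarrow> linear (z j)"
    and real: "\<And>j k. j \<in> {1..4} \<Longrightarrow> z j (\<iota> (of_real y ^ k)) = of_real (x j ^ k)"
    and imag: "\<And>j k. j \<in> {1..4} \<Longrightarrow>
        z j (\<iota> (\<i> * of_real D * of_real y ^ k)) = \<i> * of_real ((-1) ^ (j + 1) * D * x j ^ k)"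
    and x: "inj_on x {1..4}" and D: "D \<noteq> 0"
  shows "bij (\<lambda>v. (z 1 v, z 2 v, z 3 v, z 4 v))"
proof -
  define comb where "comb p q = (\<Sum>k<4. p k *\<^sub>R \<iota> (of_real y ^ k))
    + (\<Sum>k<4. q k *\<^sub>R \<iota> (\<i> * of_real D * of_real y ^ k))" for p q :: "nat \<Rightarrow> real"
  have f: "rat_linear_on F \<iota>" using V by (simp add: scalar_extension_def)
  have z_comb: "z j (comb p q) = Complex (\<Sum>k<4. p k * x j ^ k) ((-1) ^ (j + 1) * D * (\<Sum>k<4. q k * x j ^ k))"
    if j: "j \<in> {1..4}" for j p q
    unfolding comb_def
    by (simp add: linear_add[OF lin[OF j]] linear_sum[OF lin[OF j]] linear_scale[OF lin[OF j]]
        real[OF j] imag[OF j] complex_eq_iff Re_sum Im_sum del: of_real_mult of_real_power)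
      (simp add: sum_distrib_left mult_ac sum_negf)
  have comb: "\<exists>p q. v = comb p q" for v
  proof -
    let ?W = "{comb p q | p q. True}"
    have "subspace ?W"
    proof (rule subspaceI)
      have "comb (\<lambda>_. 0) (\<lambda>_. 0) = 0" by (simp add: comb_def)
      then show "0 \<in> ?W" by (metis (mono_tags, lifting) mem_Collect_eq)
    next
      fix u v assume "u \<in> ?W" "v \<in> ?W"
      then obtain p q p' q' where "u = comb p q" "v = comb p' q'" by blast
      then have "u + v = comb (\<lambda>k. p k + p' k) (\<lambda>k. q k + q' k)"
        by (simp add: comb_def scaleR_add_left sum.distrib)
      then show "u + v \<in> ?W" by blast
    next
      fix c v assume "v \<in> ?W"
      then obtain p q where "v = comb p q" by blast
      then have "c *\<^sub>R v = comb (\<lambda>k. c * p k) (\<lambda>k. c * q k)"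
        by (simp add: comb_def scaleR_add_right scaleR_sum_right)
      then show "c *\<^sub>R v \<in> ?W" by blast
    qed
    moreover have "\<iota> a \<in> ?W" if a: "a \<in> F" for a
    proof -
      obtain p q where pq: "a = (\<Sum>k<4. rat_scale (p k) (of_real y ^ k))
        + (\<Sum>k<4. rat_scale (q k) (\<i> * of_real D * of_real y ^ k))" using span[OF a] by blast
      have "\<iota> a = \<iota> (\<Sum>k<4. rat_scale (p k) (of_real y ^ k))
        + \<iota> (\<Sum>k<4. rat_scale (q k) (\<i> * of_real D * of_real y ^ k))"
        using f unfolding pq rat_linear_on_def
        by (simp add: rat_vs.subspace_sum[OF F] rat_vs.subspace_scale[OF F] t)
      also have "\<dots> = comb (\<lambda>k. of_rat (p k)) (\<lambda>k. of_rat (q k))"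
        unfolding comb_def by (simp add: rat_linear_on_sum[OF F f] t)
      finally show ?thesis by blast
    qed
    moreover obtain B where "B \<subseteq> F" "rat_vs.independent B" "F \<subseteq> rat_vs.span B"
      by (rule rat_vs.maximal_independent_subset)
    moreover from this have "rat_basis F B"
      using rat_vs.span_minimal[OF \<open>B \<subseteq> F\<close> F] by (auto simp: rat_basis_def)
    then have "Real_Vector_Spaces.span (\<iota> ` B) = UNIV" using V by (simp add: scalar_extension_def)
    ultimately have "UNIV \<subseteq> ?W" by (metis (no_types, lifting) image_subset_iff span_minimal subsetD)
    then show ?thesis by blast
  qed
  have "inj (\<lambda>v. (z 1 v, z 2 v, z 3 v, z 4 v))"
  proof (rule injI)
    fix u v assume "(z 1 u, z 2 u, z 3 u, z 4 u) = (z 1 v, z 2 v, z 3 v, z 4 v)"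
    then have 0: "z j (u - v) = 0" if "j \<in> {1..4}" for j
      using that linear_diff[OF lin[OF that], of u v] by (auto simp: ball_1_4[symmetric] atLeastAtMost_iff le_Suc_eq eval_nat_numeral)
    have vanish: "c k = 0" if c: "\<And>j. j \<in> {1..4} \<Longrightarrow> (\<Sum>k<4. c k * x j ^ k) = 0" and "k < 4"
      for c k
    proof -
      let ?p = "Abs_poly (\<lambda>k. if k < 4 then c k else 0)"
      have coeff: "Polynomial.coeff ?p = (\<lambda>k. if k < 4 then c k else 0)"
        by (rule coeff_Abs_poly[of 4]) simp
      have deg: "Polynomial.degree ?p < 4"
        using degree_le[of 3 ?p] by (auto simp: coeff)
      have "?p = 0"
      proof (rule poly_eqI_degree[of "x ` {1..4}"])
        fix s assume "s \<in> x ` {1..4}"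
        then show "poly ?p s = poly 0 s"
          using c by (auto simp: poly_eq_sum_lessThan[OF deg] coeff)
      qed (use deg card_image[OF x] in simp_all)
      then show ?thesis using coeff \<open>k < 4\<close> by (metis coeff_0)
    qed
    obtain p q where pq: "u - v = comb p q" using comb by blast
    have "(\<Sum>k<4. p k * x j ^ k) = 0" "(\<Sum>k<4. q k * x j ^ k) = 0" if "j \<in> {1..4}" for j
      using 0[OF that] D unfolding pq z_comb[OF that] by (simp_all add: complex_eq_iff)
    then have "p k = 0" "q k = 0" if "k < 4" for k using vanish that by blast+
    then have "comb p q = 0" by (simp add: comb_def)
    then show "u = v" using pq by simp
  qed
  moreover have "\<exists>v. s = (z 1 v, z 2 v, z 3 v, z 4 v)" for s
  proof -
    obtain s1 s2 s3 s4 where s: "s = (s1, s2, s3, s4)" by (cases s)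
    define S where "S j = (if j = 1 then s1 else if j = 2 then s2 else if j = 3 then s3 else s4)" for j :: nat
    obtain p where p: "Polynomial.degree p < card {1..4::nat}" "\<forall>j\<in>{1..4}. poly p (x j) = Re (S j)"
      using interpolation[OF _ _ x, of "\<lambda>j. Re (S j)"] by auto
    obtain q where q: "Polynomial.degree q < card {1..4::nat}"
      "\<forall>j\<in>{1..4}. poly q (x j) = (-1) ^ (j + 1) * Im (S j) / D"
      using interpolation[OF _ _ x, of "\<lambda>j. (-1) ^ (j + 1) * Im (S j) / D"] by auto
    have "z j (comb (Polynomial.coeff p) (Polynomial.coeff q)) = S j" if j: "j \<in> {1..4}" for j
    proof -
      define e :: real where "e = (-1) ^ (j + 1)"
      have "e * e = 1" by (simp add: e_def power_mult_distrib[symmetric])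
      moreover have "e * D * (e * Im (S j) / D) = (e * e) * Im (S j)" using D by simp
      ultimately have "e * D * (e * Im (S j) / D) = Im (S j)" by simp
      moreover have "(\<Sum>k<4. Polynomial.coeff p k * x j ^ k) = Re (S j)"
        "(\<Sum>k<4. Polynomial.coeff q k * x j ^ k) = e * Im (S j) / D"
        using p q j poly_eq_sum_lessThan[of p 4 "x j"] poly_eq_sum_lessThan[of q 4 "x j"]
        by (simp_all add: e_def)
      ultimately show ?thesis by (simp only: z_comb[OF j] e_def complex_surj)
    qed
    then show ?thesis
      by (intro exI[of _ "comb (Polynomial.coeff p) (Polynomial.coeff q)"]) (simp add: s S_def)
  qed
  then have "surj (\<lambda>v. (z 1 v, z 2 v, z 3 v, z 4 v))"
    unfolding surj_def by blast
  ultimately show ?thesis by (rule bijI)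
qed

section \<open>The polynomial, its discriminant and the embeddings\<close>

lemma DD_nonzero:
  assumes "x 1 > x 2" "x 2 > x 3" "x 3 > x 4"
  shows "DD x \<noteq> 0"
proof -
  have pairs: "{(i, j). 1 \<le> i \<and> i < j \<and> j \<le> 4} =
    {(1, 2), (1, 3), (1, 4), (2, 3), (2, 4), (3, 4::nat)}" by auto
  show ?thesis unfolding DD_def pairs using assms by (simp del: One_nat_def)
qed

text \<open>
  Four distinct roots force the degree up to 4, that is, the leading coefficient of the given
  quartic is nonzero.
\<close>

lemma degree_eq_4:
  fixes P :: "rat poly" and x :: "nat \<Rightarrow> real"
  assumes "P \<noteq> 0" and "Polynomial.degree P \<le> 4" and "inj_on x {1..4}"
    and roots: "\<And>i. i \<in> {1..4} \<Longrightarrow> poly (map_poly of_rat P) (x i) = 0"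
  shows "Polynomial.degree P = 4"
proof -
  let ?P = "map_poly real_of_rat P"
  have P0: "?P \<noteq> 0" using assms(1) by (simp add: map_poly_eq_0_iff)
  have "card (x ` {1..4}) \<le> card {t. poly ?P t = 0}"
    using roots by (intro card_mono poly_roots_finite[OF P0]) auto
  also have "\<dots> \<le> Polynomial.degree ?P" by (rule card_poly_roots_bound[OF P0])
  also have "\<dots> = Polynomial.degree P" by (simp add: degree_map_poly)
  finally show ?thesis using assms(2) card_image[OF assms(3)] by simp
qed

lemma rat_eval_of_real: "rat_eval (of_real y) p = of_real (poly (map_poly of_rat p) y)"
  by (induction p) (simp_all add: rat_eval_pCons map_poly_pCons of_real_of_rat)

lemma embedding_one: "embedding F \<phi> \<Longrightarrow> \<phi> 1 = 1"
  by (simp add: embedding_def ring_hom_def subring_of_def ring_of_type_algebra_def)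

lemma embedding_mult: "embedding F \<phi> \<Longrightarrow> a \<in> F \<Longrightarrow> b \<in> F \<Longrightarrow> \<phi> (a * b) = \<phi> a * \<phi> b"
  by (simp add: embedding_def ring_hom_def subring_of_def ring_of_type_algebra_def)

lemma embedding_power: "embedding (adjoin S) \<phi> \<Longrightarrow> a \<in> adjoin S \<Longrightarrow> \<phi> (a ^ k) = \<phi> a ^ k"
  by (induction k) (simp_all add: embedding_one embedding_mult adjoin_power)

theorem theorem6p1:
  fixes p0 p1 p2 p4 :: rat
    and x :: "nat \<Rightarrow> real"
    and F :: "complex set"
    and \<phi> :: "nat \<Rightarrow> complex \<Rightarrow> complex"
    and \<iota> :: "complex \<Rightarrow> 'v::real_vector"
    and z :: "nat \<Rightarrow> 'v \<Rightarrow> complex"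
    and c :: int
    and \<alpha>12 \<alpha>14 \<alpha>32 \<alpha>34 :: complex
    and \<alpha> :: "complex^2^2"
  assumes irred: "Factorial_Ring.irreducible [:p0, p1, p2, 0, p4:]"
    and roots: "\<forall>i\<in>{1..4}. poly (map_poly of_rat [:p0, p1, p2, 0, p4:]) (x i) = 0"
    and order: "x 1 > x 2" "x 2 > x 3" "x 3 > x 4"
    and galois: "galois_group (adjoin (x ` {1..4})) \<cong> sym_group 4"
    and Delta_int: "Delta x \<in> \<int>"
    and F_def: "F = adjoin {complex_of_real (x 1), iDD x}"
    and \<phi>: "\<forall>j\<in>{1..4}. embedding F (\<phi> j) \<and>
               \<phi> j (of_real (x 1)) = of_real (x j) \<and>
               \<phi> j (iDD x) = (-1) ^ (j + 1) * iDD x"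
    and V: "scalar_extension F \<iota>"
    and z: "\<forall>j\<in>{1..4}. linear (z j) \<and> (\<forall>a\<in>F. z j (\<iota> a) = \<phi> j a)"
    and \<alpha>_def: "\<alpha> = mat2 \<alpha>12 \<alpha>14 \<alpha>32 \<alpha>34"
    and det_\<alpha>: "det \<alpha> \<noteq> of_real ((x 2 - x 4) / (x 1 - x 3))"
    and pairing_\<alpha>: "pairing \<alpha> (H_mat x) =
           of_real (h3 x * (x 2 - x 4)) + of_real (h3 x * (x 1 - x 3)) * det \<alpha>"
  shows "(\<exists>w. w_relation x \<alpha> z w) \<and>
    (\<forall>w. w_relation x \<alpha> z w \<longrightarrow>
       complex_coordinates w \<and>
       type_1_1 w (A1_form x z) \<and>
       type_1_1 w (A2_form x c z) \<and>
       (\<alpha>34 = of_real ((x 1 - x 4) / (x 2 - x 3)) * cnj \<alpha>12 \<and>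
        \<alpha>14 = - of_real ((x 3 - x 4) / (x 1 - x 2)) * cnj \<alpha>32 \<longrightarrow>
        type_1_1 w (omega_form x z)))"
proof -
  let ?P = "[:p0, p1, p2, 0, p4:]"
  have F: "rat_vs.subspace F" unfolding F_def by (rule subspace_adjoin)
  have inj: "inj_on x {1..4}"
  proof -
    have "{1..4} = {1, 2, 3, 4::nat}" by auto
    then show ?thesis using order by (simp del: One_nat_def)
  qed
  have "?P \<noteq> 0" using irred unfolding Factorial_Ring.irreducible_def by blast
  then have degree: "Polynomial.degree ?P = 4"
    using roots by (intro degree_eq_4[OF _ _ inj]) auto
  have root: "rat_eval (of_real (x 1)) ?P = 0"
    using roots by (simp add: rat_eval_of_real del: One_nat_def)
  obtain m where "Delta x = of_int m" using Delta_int by (rule Ints_cases)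
  then have D2: "(DD x)\<^sup>2 = of_rat (of_int m)" by (simp add: Delta_def)
  have in_F: "of_real (x 1) \<in> F" "iDD x \<in> F" unfolding F_def by (simp_all add: adjoin_generator)
  have power_F: "of_real (x 1) ^ k \<in> F" for k using in_F(1) unfolding F_def by (rule adjoin_power)
  have lin: "linear (z j)" if "j \<in> {1..4}" for j using z that by blast
  have z\<iota>: "z j (\<iota> a) = \<phi> j a" if "j \<in> {1..4}" "a \<in> F" for j a using z that by blast
  have emb: "embedding F (\<phi> j)" "\<phi> j (of_real (x 1)) = of_real (x j)"
    "\<phi> j (iDD x) = (-1) ^ (j + 1) * iDD x" if "j \<in> {1..4}" for j using \<phi> that by blast+
  have \<phi>_power: "\<phi> j (of_real (x 1) ^ k) = of_real (x j) ^ k" if "j \<in> {1..4}" for j k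
    using embedding_power[OF emb(1)[OF that, unfolded F_def] in_F(1)[unfolded F_def]] emb(2)[OF that] by simp
  have bij: "bij (\<lambda>v. (z 1 v, z 2 v, z 3 v, z 4 v))"
  proof (rule bij_embeddings[OF F V, of "x 1" "DD x" z x])
    show "of_real (x 1) ^ k \<in> F" for k by (rule power_F)
    show "\<i> * of_real (DD x) * of_real (x 1) ^ k \<in> F" for k
      using adjoin_mult[OF in_F(2)[unfolded F_def] power_F[unfolded F_def]] by (simp add: F_def iDD_def)
    show "\<exists>p q. a = (\<Sum>k<4. rat_scale (p k) (of_real (x 1) ^ k))
        + (\<Sum>k<4. rat_scale (q k) (\<i> * of_real (DD x) * of_real (x 1) ^ k))" if "a \<in> F" for a
      using that unfolding F_def iDD_def
      by (intro adjoin_imaginary_quadratic_span[OF irred root D2 _ degree])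
    show "linear (z j)" if "j \<in> {1..4}" for j using that by (rule lin)
    show "z j (\<iota> (of_real (x 1) ^ k)) = of_real (x j ^ k)" if "j \<in> {1..4}" for j k
      using that by (simp only: z\<iota> power_F \<phi>_power of_real_power)
    show "z j (\<iota> (\<i> * of_real (DD x) * of_real (x 1) ^ k)) = \<i> * of_real ((-1) ^ (j + 1) * DD x * x j ^ k)"
      if "j \<in> {1..4}" for j k
    proof -
      have "iDD x * of_real (x 1) ^ k \<in> F"
        using in_F(2) power_F unfolding F_def by (rule adjoin_mult)
      then have "z j (\<iota> (iDD x * of_real (x 1) ^ k)) = (-1) ^ (j + 1) * iDD x * of_real (x j) ^ k"
        by (simp only: z\<iota>[OF that] embedding_mult[OF emb(1)[OF that] in_F(2) power_F] \<phi>_power[OF that] emb(3)[OF that])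
      then show ?thesis by (simp add: iDD_def)
    qed
    show "inj_on x {1..4}" by (rule inj)
    show "DD x \<noteq> 0" using order by (rule DD_nonzero)
  qed
  \<comment> \<open>the condition on the determinant in the form that is used to solve for \<open>w\<close>\<close>
  have nz: "det \<alpha> * of_real ((x 1 - x 3) / (x 2 - x 4)) \<noteq> 1"
  proof
    assume 1: "det \<alpha> * of_real ((x 1 - x 3) / (x 2 - x 4)) = 1"
    have "(x 1 - x 3) / (x 2 - x 4) * ((x 2 - x 4) / (x 1 - x 3)) = 1" using order by simp
    then have "of_real ((x 1 - x 3) / (x 2 - x 4)) * of_real ((x 2 - x 4) / (x 1 - x 3)) = (1::complex)"
      by (metis of_real_1 of_real_mult)
    then have "det \<alpha> = det \<alpha> * of_real ((x 1 - x 3) / (x 2 - x 4)) * of_real ((x 2 - x 4) / (x 1 - x 3))"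
      by (simp only: mult.assoc mult_1_right)
    then show False using det_\<alpha> by (simp only: 1 mult_1_left not_True_eq_False)
  qed
  show ?thesis
  proof (intro conjI allI impI)
    show "\<exists>w. w_relation x \<alpha> z w" using w_relation_solution[OF nz] by blast
  next
    fix w assume w: "w_relation x \<alpha> z w"
    show "complex_coordinates w" using w nz lin bij by (rule complex_coordinates_w)
    have A: "type_1_1 w (A_plus x z)"
      using type_1_1_A_plus[OF w _ pairing_\<alpha>] order by simp
    show "type_1_1 w (A1_form x z)"
      unfolding A1_form_def by (rule type_1_1_add[OF A type_1_1_conj2[OF A]])
    show "type_1_1 w (A2_form x c z)"
      unfolding A2_form_def by (rule type_1_1_scale[OF type_1_1_diff[OF A type_1_1_conj2[OF A]]])
    assume "\<alpha>34 = of_real ((x 1 - x 4) / (x 2 - x 3)) * cnj \<alpha>12 \<and>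
      \<alpha>14 = - of_real ((x 3 - x 4) / (x 1 - x 2)) * cnj \<alpha>32"
    then show "type_1_1 w (omega_form x z)"
      by (intro type_1_1_omega[OF w order]) (simp_all only: \<alpha>_def mat2_nth)
  qed
qed

end
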